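(* Let $T>0$, let $d,q,M\ge 1$ be integers, $p\in[2,+\infty)$, and let $b:[0,T]\times\mathbb{R}^d\times\mathcal{P}_p(\mathbb{R}^d)\to\mathbb{R}^d$ and $\sigma,\theta:[0,T]\times\mathbb{R}^d\times\mathcal{P}_p(\mathbb{R}^d)\to\mathbb{M}_{d\times q}$. Let $X_0,Y_0\in L^p(\mathbb{P})$ be $\mathbb{R}^d$-valued. Assume that there are $\rho\in(0,1]$ and $L,\tilde L>0$ such that for all $0\le s\le t\le T$, $x,y\in\mathbb{R}^d$, $\mu,\nu\in\mathcal{P}_p(\mathbb{R}^d)$, and for each $f\in\{b,\sigma,\theta\}$ (with the Euclidean norm for $b$ and the operator norm for $\sigma,\theta$), $$\|f(t,x,\mu)-f(s,x,\mu)\|\le \tilde L\big(1+|x|+\mathcal{W}_p(\mu,\delta_0)\big)(t-s)^\rho,\qquad \|f(t,x,\mu)-f(t,y,\nu)\|\le L\big(|x-y|+\mathcal{W}_p(\mu,\nu)\big).$$ With $h=T/M$, $t_m=mh$, put for $m=0,\dots,M$ $$b_m(x,\mu)=x+h\,b(t_m,x,\mu),\quad \sigma_m(x,\mu)=\sqrt h\,\sigma(t_m,x,\mu),\quad \theta_m(x,\mu)=\sqrt h\,\theta(t_m,x,\mu),$$ and assume for all $m=0,\dots,M$: (1) $b_m$ is affine in $x$, and $b_m(x,\mu)=b_m(x,\nu)$ for all $x$ whenever $\mu,\nu\in\mathcal{P}_p(\mathbb{R}^d)$, $\mu\preceq_{cv}\nu$; (2) $\sigma_m(\lambda x+(1-\lambda)y,\mu)\preceq\lambda\sigma_m(x,\mu)+(1-\lambda)\sigma_m(y,\mu)$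 for all $x,y\in\mathbb{R}^d$, $\lambda\in[0,1]$, $\mu\in\mathcal{P}_p(\mathbb{R}^d)$; (3) $\sigma_m(x,\mu)\preceq\sigma_m(x,\nu)$ for all $x$ whenever $\mu,\nu\in\mathcal{P}_p(\mathbb{R}^d)$, $\mu\preceq_{cv}\nu$; (4) $\sigma_m(x,\mu)\preceq\theta_m(x,\mu)$ for all $(x,\mu)\in\mathbb{R}^d\times\mathcal{P}_p(\mathbb{R}^d)$; and (5) $X_0\preceq_{cv}Y_0$. Let $\bar X_0=X_0$, $\bar Y_0=Y_0$ and, for $m=0,\dots,M-1$, $$\bar X_{m+1}=b_m(\bar X_m,\bar\mu_m)+\sigma_m(\bar X_m,\bar\mu_m)Z_{m+1},\qquad \bar Y_{m+1}=b_m(\bar Y_m,\bar\nu_m)+\theta_m(\bar Y_m,\bar\nu_m)Z_{m+1},$$ where $\bar\mu_m,\bar\nu_m$ are the distributions of $\bar X_m,\bar Y_m$, and $Z_1,\dots,Z_M$ are i.i.d. $\mathcal{N}(0,\mathbf{I}_q)$, independent of $(X_0,Y_0)$. Then $\bar X_m\preceq_{cv}\bar Y_m$ for every $m=0,\dots,M$.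
   Context: All random variables live on a probability space $(\Omega,\mathcal{F},\mathbb{P})$. $\mathbb{M}_{d\times q}$ is the set of real $d\times q$ matrices with operator norm $\sup_{|z|\le1}|Az|$; for $A,B\in\mathbb{M}_{d\times q}$, $A\preceq B$ means that $BB^\top-AA^\top$ is positive semi-definite. $\mathcal{P}_p(\mathbb{R}^d)$ is the set of probability distributions on $\mathbb{R}^d$ with finite $p$-th moment, $\mathcal{W}_p$ is the $L^p$-Wasserstein distance (for the Euclidean norm $|\cdot|$), $\delta_0$ is the Dirac mass at $0$. Convex order: for $\mu,\nu\in\mathcal{P}_1(\mathbb{R}^d)$, $\mu\preceq_{cv}\nu$ means $\int\varphi\,d\mu\le\int\varphi\,d\nu$ for every convex $\varphi:\mathbb{R}^d\to\mathbb{R}$ (integrals in $(-\infty,+\infty]$); for integrable random variables, $U\preceq_{cv}V$ means that their distributions are so ordered. *)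

theory Defs
  imports "HOL-Probability.Probability"
begin

definition op_norm :: "real ^ 'q ^ 'd \<Rightarrow> real" where
  "op_norm A = onorm (\<lambda>z. A *v z)"

definition pos_semidef :: "real ^ 'd ^ 'd \<Rightarrow> bool" where
  "pos_semidef Q \<longleftrightarrow> transpose Q = Q \<and> (\<forall>v. 0 \<le> v \<bullet> (Q *v v))"

definition mat_le :: "real ^ 'q ^ 'd \<Rightarrow> real ^ 'q ^ 'd \<Rightarrow> bool"  (infix "\<preceq>\<^sub>M" 50) where
  "A \<preceq>\<^sub>M B \<longleftrightarrow> pos_semidef (B ** transpose B - A ** transpose A)"

definition prob_dists :: "real \<Rightarrow> (real ^ 'd) measure set" where
  "prob_dists p = {\<mu>. sets \<mu> = sets borel \<and> prob_space \<mu> \<and> integrable \<mu> (\<lambda>x. norm x powr p)}"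

definition couplings ::
    "(real ^ 'd) measure \<Rightarrow> (real ^ 'd) measure \<Rightarrow> ((real ^ 'd) \<times> (real ^ 'd)) measure set" where
  "couplings \<mu> \<nu> = {\<pi>. sets \<pi> = sets (borel \<Otimes>\<^sub>M borel) \<and> prob_space \<pi> \<and>
     distr \<pi> borel fst = \<mu> \<and> distr \<pi> borel snd = \<nu>}"

text \<open>On \<^term>\<open>prob_dists p\<close> with \<^prop>\<open>1 \<le> p\<close> the infimum is finite, so \<^const>\<open>enn2real\<close>
  loses nothing there.\<close>

definition wasserstein :: "real \<Rightarrow> (real ^ 'd) measure \<Rightarrow> (real ^ 'd) measure \<Rightarrow> real" where
  "wasserstein p \<mu> \<nu> =
     enn2real (INF \<pi>\<in>couplings \<mu> \<nu>. \<integral>\<^sup>+ z. ennreal (norm (fst z - snd z) powr p) \<partial>\<pi>) powr (1 / p)"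

text \<open>The integral of the positive part minus that of the negative part. For convex integrands and
  \<^term>\<open>\<mu> \<in> prob_dists 1\<close> the latter is finite (a convex function has an affine minorant), so the
  value lies in $(-\infty,+\infty]$.\<close>

definition ext_integral :: "(real ^ 'd) measure \<Rightarrow> (real ^ 'd \<Rightarrow> real) \<Rightarrow> ereal" where
  "ext_integral \<mu> \<phi> =
     enn2ereal (\<integral>\<^sup>+ x. ennreal (\<phi> x) \<partial>\<mu>) - enn2ereal (\<integral>\<^sup>+ x. ennreal (- \<phi> x) \<partial>\<mu>)"

definition cv_le :: "(real ^ 'd) measure \<Rightarrow> (real ^ 'd) measure \<Rightarrow> bool"  (infix "\<preceq>\<^sub>c\<^sub>v" 50) where
  "\<mu> \<preceq>\<^sub>c\<^sub>v \<nu> \<longleftrightarrow> \<mu> \<in> prob_dists 1 \<and> \<nu> \<in> prob_dists 1 \<and>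
     (\<forall>\<phi>. convex_on UNIV \<phi> \<longrightarrow> ext_integral \<mu> \<phi> \<le> ext_integral \<nu> \<phi>)"

definition cv_le_rv :: "'a measure \<Rightarrow> ('a \<Rightarrow> real ^ 'd) \<Rightarrow> ('a \<Rightarrow> real ^ 'd) \<Rightarrow> bool" where
  "cv_le_rv P U V \<longleftrightarrow> integrable P U \<and> integrable P V \<and> distr P borel U \<preceq>\<^sub>c\<^sub>v distr P borel V"

definition Lp_rv :: "real \<Rightarrow> 'a measure \<Rightarrow> ('a \<Rightarrow> real ^ 'd) \<Rightarrow> bool" where
  "Lp_rv p P U \<longleftrightarrow> U \<in> borel_measurable P \<and> integrable P (\<lambda>\<omega>. norm (U \<omega>) powr p)"

text \<open>The parameter \<open>nrm\<close> is the norm on the values of \<open>f\<close>.\<close>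

definition holder_lipschitz ::
    "('c :: ab_group_add \<Rightarrow> real) \<Rightarrow> real \<Rightarrow> real \<Rightarrow> real \<Rightarrow> real \<Rightarrow> real \<Rightarrow>
     (real \<Rightarrow> real ^ 'd \<Rightarrow> (real ^ 'd) measure \<Rightarrow> 'c) \<Rightarrow> bool" where
  "holder_lipschitz nrm p T \<rho> L L' f \<longleftrightarrow>
     (\<forall>s t x y. \<forall>\<mu>\<in>prob_dists p. \<forall>\<nu>\<in>prob_dists p. 0 \<le> s \<and> s \<le> t \<and> t \<le> T \<longrightarrow>
        nrm (f t x \<mu> - f s x \<mu>)
          \<le> L' * (1 + norm x + wasserstein p \<mu> (return borel 0)) * (t - s) powr \<rho> \<and>
        nrm (f t x \<mu> - f t y \<nu>) \<le> L * (norm (x - y) + wasserstein p \<mu> \<nu>))"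

definition drift_step ::
    "real \<Rightarrow> nat \<Rightarrow> (real \<Rightarrow> real ^ 'd \<Rightarrow> (real ^ 'd) measure \<Rightarrow> real ^ 'd) \<Rightarrow>
     nat \<Rightarrow> real ^ 'd \<Rightarrow> (real ^ 'd) measure \<Rightarrow> real ^ 'd" where
  "drift_step T M b m x \<mu> = (let h = T / real M in x + h *\<^sub>R b (real m * h) x \<mu>)"

definition diffusion_step ::
    "real \<Rightarrow> nat \<Rightarrow> (real \<Rightarrow> real ^ 'd \<Rightarrow> (real ^ 'd) measure \<Rightarrow> real ^ 'q ^ 'd) \<Rightarrow>
     nat \<Rightarrow> real ^ 'd \<Rightarrow> (real ^ 'd) measure \<Rightarrow> real ^ 'q ^ 'd" where
  "diffusion_step T M \<sigma> m x \<mu> = (let h = T / real M in sqrt h *\<^sub>R \<sigma> (real m * h) x \<mu>)"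

primrec euler_scheme ::
    "'a measure \<Rightarrow> (nat \<Rightarrow> real ^ 'd \<Rightarrow> (real ^ 'd) measure \<Rightarrow> real ^ 'd) \<Rightarrow>
     (nat \<Rightarrow> real ^ 'd \<Rightarrow> (real ^ 'd) measure \<Rightarrow> real ^ 'q ^ 'd) \<Rightarrow>
     (nat \<Rightarrow> 'a \<Rightarrow> real ^ 'q) \<Rightarrow> ('a \<Rightarrow> real ^ 'd) \<Rightarrow> nat \<Rightarrow> 'a \<Rightarrow> real ^ 'd" where
  "euler_scheme P bs ss Z X0 0 = X0"
| "euler_scheme P bs ss Z X0 (Suc m) =
     (let X = euler_scheme P bs ss Z X0 m; \<mu> = distr P borel X
      in (\<lambda>\<omega>. bs m (X \<omega>) \<mu> + ss m (X \<omega>) \<mu> *v Z (Suc m) \<omega>))"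

definition std_gaussian_density :: "real ^ 'q \<Rightarrow> real" where
  "std_gaussian_density z = exp (- (norm z)\<^sup>2 / 2) / sqrt ((2 * pi) ^ CARD('q))"

text \<open>The library's \<open>indep_var\<close> requires both variables to take values in the same type. Here
  independence of the generated sigma-algebras is used instead.\<close>

definition indep_rv ::
    "'a measure \<Rightarrow> 'b measure \<Rightarrow> ('a \<Rightarrow> 'b) \<Rightarrow> 'c measure \<Rightarrow> ('a \<Rightarrow> 'c) \<Rightarrow> bool" where
  "indep_rv P S U S' V \<longleftrightarrow> U \<in> measurable P S \<and> V \<in> measurable P S' \<and>
     prob_space.indep_set P
       (sets (vimage_algebra (space P) U S)) (sets (vimage_algebra (space P) V S'))"

end

theory Submission
  imports Defs
begin

text \<open>
  Since \<open>A \<preceq>\<^sub>M B\<close> means that $|A^\top x| \le |B^\top x|$ for all $x$, one can write $A = BK$ with $K$ a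
  contraction, and by Krein--Milman $K$ is a convex combination of orthogonal matrices. As the Gaussian law
  is rotation invariant and $A \mapsto E f(c + AZ)$ is convex for convex $f$, it follows that
  $E f(c + AZ) \le E f(c + BZ)$.

  The convex order is determined by Lipschitz convex test functions $f$, for which
  $Qf(x) = E f(b(x) + \sigma(x)Z)$ is again convex and integrable: convexity combines the convexity of
  $\sigma$ in $x$ with the monotonicity above. Hence one step of the scheme preserves the convex order, and the
  claim follows by induction, the law of the next state being determined by that of the current one because
  the current state is independent of the remaining noise.
\<close>

section \<open>Contractions and the matrix order\<close>

text \<open>The contraction stands to the right of B, on the side of the noise: this is why d and q
  may differ and why the Gaussian absorbs the rotations. Convexity in the state is assumed for
  \<sigma> and not for \<theta>, which fixes the order of comparison within a step: the starting law
  is changed first, with \<sigma> frozen at the law of the smaller chain, and only then is \<sigma>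
  replaced by \<theta>. The two kernels must share their drift; the induction hypothesis provides
  this, since laws in convex order give the same drift. Arbitrary convex test functions may have
  infinite integrals. Lipschitz ones grow at most linearly, so first moments make every integral in
  a step finite and Fubini applies. Finiteness of the p-th moments has to be carried along the
  induction, because the coefficients are controlled only at such laws.\<close>

text \<open>If the contraction K is no isometry, its smallest singular value s is below 1. Replacing
  s by 1 or by 2s - 1, with the same singular vectors, gives two distinct contractions with midpoint
  K, so K is not extreme.\<close>

lemma contraction_extreme_imp_isometry:
  fixes K :: "real ^ 'n ^ 'n"
  assumes ext: "K extreme_point_of {K. \<forall>x. norm (K *v x) \<le> norm x}"
  shows "norm (K *v x) = norm x"
proof (rule ccontr)
  assume ne: "norm (K *v x) \<noteq> norm x"
  have con: "norm (K *v y) \<le> norm y" for y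
    using ext by (simp add: extreme_point_of_def)
  have "x \<noteq> 0"
    using ne by auto
  have "continuous_on (sphere 0 1) (\<lambda>y. norm (K *v y))"
    by (intro continuous_intros linear_continuous_on linear_linear[THEN iffD2]) simp
  moreover have "sphere 0 1 \<noteq> ({} :: (real ^ 'n) set)"
    by simp
  ultimately obtain v where v: "norm v = 1" and vmin: "\<And>y. norm y = 1 \<Longrightarrow> norm (K *v v) \<le> norm (K *v y)"
    using continuous_attains_inf[of "sphere 0 1" "\<lambda>y. norm (K *v y)"] by auto
  define s where "s = norm (K *v v)"
  have "s \<le> norm (K *v ((1 / norm x) *\<^sub>R x))"
    unfolding s_def by (rule vmin) (use \<open>x \<noteq> 0\<close> in simp)
  also have "\<dots> = norm (K *v x) / norm x"
    by (simp add: matrix_vector_mult_scaleR)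
  also have "\<dots> < 1"
    using con[of x] ne \<open>x \<noteq> 0\<close> by simp
  finally have s1: "s < 1" .
  have s0: "0 \<le> s"
    by (simp add: s_def)
  have vmin': "s * norm y \<le> norm (K *v y)" for y
  proof (cases "y = 0")
    case False
    have "s \<le> norm (K *v ((1 / norm y) *\<^sub>R y))"
      unfolding s_def by (rule vmin) (use False in simp)
    also have "\<dots> = norm (K *v y) / norm y"
      by (simp add: matrix_vector_mult_scaleR)
    finally show ?thesis
      using False by (simp add: field_simps)
  qed simp
  \<comment> \<open>First variation of the minimum: moving v in a direction w orthogonal to it
    changes |v + t w| only to second order in t, so the first-order term 2ta of |K(v + t w)|^2 must
    vanish.\<close>
  have orth: "(K *v v) \<bullet> (K *v w) = 0" if w: "v \<bullet> w = 0" for w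
  proof (rule ccontr)
    define a where "a = (K *v v) \<bullet> (K *v w)"
    define c where "c = (norm (K *v w))\<^sup>2 - s\<^sup>2 * (norm w)\<^sup>2"
    assume "(K *v v) \<bullet> (K *v w) \<noteq> 0"
    then have a: "a \<noteq> 0" by (simp add: a_def)
    have c: "c \<ge> 0"
      using power_mono[OF vmin'[of w], of 2] s0 by (simp add: c_def power_mult_distrib)
    \<comment> \<open>Close to the minimiser -a/c of 2ta + ct^2; the denominator c + 1 also covers c
      = 0 and still makes the value negative.\<close>
    define t where "t = - a / (c + 1)"
    have "(s * norm (v + t *\<^sub>R w))\<^sup>2 \<le> (norm (K *v (v + t *\<^sub>R w)))\<^sup>2"
      by (intro power_mono vmin') (simp add: s0)
    then have "0 \<le> 2 * t * a + t\<^sup>2 * c"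
      using w v unfolding power_mult_distrib power2_norm_eq_inner a_def c_def s_def
      by (simp add: matrix_vector_right_distrib matrix_vector_mult_scaleR inner_add_left inner_add_right
          inner_commute algebra_simps power2_eq_square norm_eq_1)
    moreover have "2 * t * a + t\<^sup>2 * c = a\<^sup>2 * (- c - 2) / (c + 1)\<^sup>2"
      using c unfolding t_def by (simp add: divide_simps) (simp add: algebra_simps power2_eq_square)
    moreover have "a\<^sup>2 * (- c - 2) / (c + 1)\<^sup>2 < 0"
      using a c by (intro divide_neg_pos mult_pos_neg) auto
    ultimately show False by simp
  qed
  \<comment> \<open>For s > 0, u is the direction of Kv. For s = 0 that direction is lost, but K is
    singular, hence not onto, and any unit vector orthogonal to its range serves.\<close>
  obtain u where u: "norm u = 1" and Kv: "K *v v = s *\<^sub>R u"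
    and uorth: "\<And>w. v \<bullet> w = 0 \<Longrightarrow> u \<bullet> (K *v w) = 0"
  proof (cases "s = 0")
    case False
    show ?thesis
    proof
      show "norm ((1 / s) *\<^sub>R (K *v v)) = 1" "K *v v = s *\<^sub>R ((1 / s) *\<^sub>R (K *v v))"
        using False s0 by (auto simp: s_def)
    qed (simp add: orth)
  next
    case True
    then have Kv0: "K *v v = 0"
      by (simp add: s_def)
    have "\<not> inj ((*v) K)"
      using Kv0 v by (metis injD matrix_vector_mult_0_right norm_zero zero_neq_one)
    then have "range ((*v) K) \<noteq> UNIV"
      using linear_surjective_imp_injective[of "(*v) K"] by auto
    moreover have "span (range ((*v) K)) = range ((*v) K)"
      by (intro span_eq_iff[THEN iffD2] linear_subspace_image matrix_vector_mul_linear subspace_UNIV)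
    ultimately obtain a where a: "a \<noteq> 0" "\<forall>y \<in> range ((*v) K). a \<bullet> y = 0"
      using span_not_UNIV_orthogonal[of "range ((*v) K)"] by metis
    show ?thesis
    proof
      show "norm (sgn a) = 1" using a by (simp add: norm_sgn)
      show "K *v v = s *\<^sub>R sgn a" by (simp add: True Kv0)
      show "sgn a \<bullet> (K *v w) = 0" for w using a by (simp add: sgn_div_norm)
    qed
  qed
  \<comment> \<open>\<open>v\<close> minimises $|Kv|$ on the sphere, so \<open>K\<close> maps its orthogonal complement into that of \<open>u\<close>. Hence
    adding or subtracting $(1 - s) u v^\top$ keeps \<open>K\<close> a contraction.\<close>
  define N :: "real ^ 'n ^ 'n" where "N = (\<chi> i j. (1 - s) * u $ i * v $ j)"
  have N: "N *v y = ((1 - s) * (v \<bullet> y)) *\<^sub>R u" for y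
    by (simp add: N_def matrix_vector_mult_def vec_eq_iff inner_vec_def sum_distrib_left sum_distrib_right algebra_simps)
  have key: "norm ((K + r *\<^sub>R N) *v y) \<le> norm y" if r: "\<bar>r\<bar> = 1" for r y
  proof -
    define a where "a = v \<bullet> y"
    define w where "w = y - a *\<^sub>R v"
    have vw: "v \<bullet> w = 0"
      using v by (simp add: w_def a_def inner_diff_right norm_eq_1)
    have y: "y = a *\<^sub>R v + w" by (simp add: w_def)
    have "(K + r *\<^sub>R N) *v y = (a * (s + r * (1 - s))) *\<^sub>R u + K *v w"
      unfolding matrix_vector_mult_add_rdistrib scaleR_matrix_vector_assoc[symmetric] N
      by (subst y) (simp add: matrix_vector_right_distrib matrix_vector_mult_scaleR Kv a_def[symmetric] algebra_simps)
    then have "(norm ((K + r *\<^sub>R N) *v y))\<^sup>2 = (norm ((a * (s + r * (1 - s))) *\<^sub>R u))\<^sup>2 + (norm (K *v w))\<^sup>2"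
      by (simp add: norm_add_Pythagorean orthogonal_def uorth[OF vw])
    also have "\<dots> = a\<^sup>2 * (s + r * (1 - s))\<^sup>2 + (norm (K *v w))\<^sup>2"
      by (simp add: u power_mult_distrib)
    also have "\<dots> \<le> a\<^sup>2 * 1 + (norm w)\<^sup>2"
    proof (intro add_mono mult_left_mono power_mono con)
      have "r = 1 \<or> r = -1" using r by linarith
      then have "\<bar>s + r * (1 - s)\<bar> \<le> 1" using s0 s1 by auto
      then show "(s + r * (1 - s))\<^sup>2 \<le> 1" by (simp add: abs_square_le_1)
    qed auto
    also have "\<dots> = (norm y)\<^sup>2"
      using vw v by (subst y) (simp add: norm_add_Pythagorean orthogonal_def)
    finally show ?thesis
      using norm_ge_zero by (rule power2_le_imp_le)
  qed
  have "N \<noteq> 0"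
  proof
    assume "N = 0"
    then have "N *v v = 0" by simp
    then show False using N[of v] v u s1 by (auto simp: norm_eq_1)
  qed
  then have "K \<in> open_segment (K - N) (K + N)"
    unfolding in_segment
    by (auto intro!: exI[of _ "1/2"] simp: algebra_simps scaleR_2[symmetric])
  moreover have "K - N \<in> {K. \<forall>x. norm (K *v x) \<le> norm x}" "K + N \<in> {K. \<forall>x. norm (K *v x) \<le> norm x}"
    using key[of "-1"] key[of 1] by auto
  ultimately show False
    using ext unfolding extreme_point_of_def by blast
qed

text \<open>The norm of the matrix type is the Euclidean norm of the entries, not the operator norm.
  Each entry is a coordinate of the image of a basis vector, hence at most B in absolute value. The
  crude dimension factor is harmless for boundedness and continuity.\<close>

lemma norm_matrix_le:
  fixes K :: "real ^ 'n ^ 'm"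
  assumes K: "\<And>x. norm (K *v x) \<le> B * norm x"
  shows "norm K \<le> real CARD('m) * (real CARD('n) * B)"
proof -
  have "\<bar>K $ i $ j\<bar> \<le> B" for i j
  proof -
    have "K $ i $ j = (K *v axis j 1) $ i"
      by (metis column_def matrix_vector_mult_basis vec_lambda_beta)
    also have "\<bar>\<dots>\<bar> \<le> norm (K *v axis j 1)"
      by (rule component_le_norm_cart)
    also have "\<dots> \<le> B"
      using K[of "axis j 1"] by simp
    finally show ?thesis .
  qed
  then have "norm (K $ i) \<le> real CARD('n) * B" for i
    using norm_le_l1_cart[of "K $ i"] sum_mono[of UNIV "\<lambda>j. \<bar>K $ i $ j\<bar>" "\<lambda>_. B"] by simp
  then have "(\<Sum>i\<in>UNIV. norm (K $ i)) \<le> (\<Sum>i::'m\<in>UNIV. real CARD('n) * B)"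
    by (intro sum_mono)
  moreover have "norm K \<le> (\<Sum>i\<in>UNIV. norm (K $ i))"
    unfolding norm_vec_def by (rule L2_set_le_sum) simp
  ultimately show ?thesis
    by simp
qed

lemma compact_contractions: "compact {K :: real ^ 'n ^ 'm. \<forall>x. norm (K *v x) \<le> norm x}"
  unfolding compact_eq_bounded_closed
proof
  show "bounded {K :: real ^ 'n ^ 'm. \<forall>x. norm (K *v x) \<le> norm x}"
    unfolding bounded_iff using norm_matrix_le[where B = 1] by auto
  have "{K :: real ^ 'n ^ 'm. \<forall>x. norm (K *v x) \<le> norm x} = (\<Inter>x. {K. norm (K *v x) \<le> norm x})"
    by auto
  moreover have "closed {K :: real ^ 'n ^ 'm. norm (K *v x) \<le> norm x}" for x
    unfolding matrix_vector_mult_def by (intro closed_Collect_le continuous_intros)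
  ultimately show "closed {K :: real ^ 'n ^ 'm. \<forall>x. norm (K *v x) \<le> norm x}"
    by auto
qed

lemma convex_contractions: "convex {K :: real ^ 'n ^ 'm. \<forall>x. norm (K *v x) \<le> norm x}"
proof (rule convexI, safe)
  fix K N :: "real ^ 'n ^ 'm" and a b :: real and x
  assume *: "\<forall>x. norm (K *v x) \<le> norm x" "\<forall>x. norm (N *v x) \<le> norm x" "0 \<le> a" "0 \<le> b" "a + b = 1"
  have "norm ((a *\<^sub>R K + b *\<^sub>R N) *v x) \<le> a * norm (K *v x) + b * norm (N *v x)"
    unfolding matrix_vector_mult_add_rdistrib scaleR_matrix_vector_assoc[symmetric]
    using * by (metis (no_types) abs_of_nonneg norm_scaleR norm_triangle_ineq)
  also have "\<dots> \<le> a * norm x + b * norm x"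
    using * by (intro add_mono mult_left_mono) auto
  finally show "norm ((a *\<^sub>R K + b *\<^sub>R N) *v x) \<le> norm x"
    using * by (simp add: distrib_right[symmetric])
qed

text \<open>In finite dimension a compact convex set is the hull of its extreme points without
  taking a closure. Hence a function on matrices can later be bounded on the hull by convexity
  alone, with no continuity argument.\<close>

lemma contraction_in_hull_orthogonal:
  fixes K :: "real ^ 'n ^ 'n"
  assumes "\<And>x. norm (K *v x) \<le> norm x"
  shows "K \<in> convex hull {U. orthogonal_matrix U}"
proof -
  let ?C = "{K :: real ^ 'n ^ 'n. \<forall>x. norm (K *v x) \<le> norm x}"
  have "orthogonal_matrix U" if "U extreme_point_of ?C" for U
    using contraction_extreme_imp_isometry[OF that]
    by (metis matrix_of_matrix_vector_mul matrix_vector_mul_linear orthogonal_transformation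
        orthogonal_transformation_matrix)
  then have "{U. U extreme_point_of ?C} \<subseteq> {U. orthogonal_matrix U}"
    by blast
  moreover have "K \<in> convex hull {U. U extreme_point_of ?C}"
    using Krein_Milman_Minkowski[OF compact_contractions convex_contractions] assms by blast
  ultimately show ?thesis
    using hull_mono by blast
qed

section \<open>Factorisation of matrices that are comparable in the order\<close>

lemma mat_le_iff_norm_transpose:
  "A \<preceq>\<^sub>M B \<longleftrightarrow> (\<forall>x. norm (transpose A *v x) \<le> norm (transpose B *v x))"
proof -
  have quad: "x \<bullet> (C ** transpose C *v x) = (norm (transpose C *v x))\<^sup>2" for C :: "real ^ 'q ^ 'd" and x
    by (metis dot_lmul_matrix matrix_vector_mul_assoc power2_norm_eq_inner transpose_matrix_vector transpose_transpose)
  have "transpose (B ** transpose B - A ** transpose A) = B ** transpose B - A ** transpose A"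
    by (simp add: transpose_def matrix_matrix_mult_def vec_eq_iff mult.commute)
  then show ?thesis
    unfolding mat_le_def pos_semidef_def
    by (simp add: matrix_vector_mult_diff_rdistrib inner_diff_right quad)
qed

lemma mat_le_trans: "A \<preceq>\<^sub>M B \<Longrightarrow> B \<preceq>\<^sub>M C \<Longrightarrow> A \<preceq>\<^sub>M C"
  unfolding mat_le_iff_norm_transpose by (meson order_trans)

text \<open>The norm inequality makes the map from (transpose of B) x to (transpose of A) x well
  defined and contracting on the range of the transpose of B. Composing it with the orthogonal
  projection onto that range extends it to a contraction of the whole space.\<close>

lemma mat_le_factor_contraction:
  fixes A B :: "real ^ 'q ^ 'd"
  assumes "A \<preceq>\<^sub>M B"
  obtains K :: "real ^ 'q ^ 'q" where "\<And>y. norm (K *v y) \<le> norm y" "transpose A = K ** transpose B"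
proof -
  have le: "norm (transpose A *v x) \<le> norm (transpose B *v x)" for x
    using assms by (simp add: mat_le_iff_norm_transpose)
  obtain g where g: "linear g" "\<And>y. y \<in> range ((*v) (transpose B)) \<Longrightarrow> transpose B *v g y = y"
    using linear_exists_right_inverse_on[of "(*v) (transpose B)" UNIV] by auto
  have sub: "subspace (range ((*v) (transpose B)))"
    by (intro linear_subspace_image matrix_vector_mul_linear subspace_UNIV)
  obtain Bs where Bs: "pairwise orthogonal Bs" "\<And>x. x \<in> Bs \<Longrightarrow> norm x = 1" "span Bs = range ((*v) (transpose B))"
    using orthonormal_basis_subspace[OF sub] by metis
  \<comment> \<open>the orthogonal projection onto the range of $B^\top$\<close>
  define Pr where "Pr y = (\<Sum>b\<in>Bs. (b \<bullet> y / (b \<bullet> b)) *\<^sub>R b)" for y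
  have Pr_in: "Pr y \<in> range ((*v) (transpose B))" for y
    unfolding Pr_def Bs(3)[symmetric] by (intro span_sum span_scale span_base)
  have orth: "x \<bullet> (y - Pr y) = 0" if "x \<in> range ((*v) (transpose B))" for x y
    using Gram_Schmidt_step[OF Bs(1), of x y] that unfolding Bs(3) Pr_def by (simp add: orthogonal_def)
  have lin: "linear Pr"
    unfolding Pr_def by (intro linear_compose_sum ballI linearI)
      (auto simp: inner_add_right add_divide_distrib scaleR_add_left)
  have Pr_le: "norm (Pr y) \<le> norm y" for y
  proof -
    have "(norm (Pr y + (y - Pr y)))\<^sup>2 = (norm (Pr y))\<^sup>2 + (norm (y - Pr y))\<^sup>2"
      by (rule norm_add_Pythagorean) (simp add: orthogonal_def orth[OF Pr_in])
    then have "(norm (Pr y))\<^sup>2 \<le> (norm y)\<^sup>2" by simp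
    then show ?thesis by (simp add: power2_le_iff_abs_le)
  qed
  have Pr_id: "Pr y = y" if "y \<in> range ((*v) (transpose B))" for y
  proof -
    have "(y - Pr y) \<bullet> (y - Pr y) = 0"
      by (intro orth subspace_diff[OF sub] that Pr_in)
    then show ?thesis by simp
  qed
  define K where "K = matrix (\<lambda>y. transpose A *v g (Pr y))"
  have K: "K *v y = transpose A *v g (Pr y)" for y
    unfolding K_def
    by (rule fun_cong[OF matrix_vector_mul(2)])
      (rule linear_compose[OF linear_compose[OF lin g(1)] matrix_vector_mul_linear, unfolded o_def])
  show ?thesis
  proof
    show "norm (K *v y) \<le> norm y" for y
      using le[of "g (Pr y)"] Pr_le[of y] unfolding K g(2)[OF Pr_in] by linarith
    \<comment> \<open>Well-definedness: \<open>g (transpose B *v x)\<close> and x differ by a vector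
      in the kernel of the transpose of B, which by the norm inequality lies in the kernel of the
      transpose of A.\<close>
    have "K *v (transpose B *v x) = transpose A *v x" for x
    proof -
      have "norm (transpose A *v (g (transpose B *v x) - x)) \<le> norm (transpose B *v (g (transpose B *v x) - x))"
        by (rule le)
      also have "\<dots> = 0"
        by (simp add: matrix_vector_mult_diff_distrib g(2) del: transpose_matrix_vector)
      finally show ?thesis
        by (simp add: K Pr_id matrix_vector_mult_diff_distrib del: transpose_matrix_vector)
    qed
    then show "transpose A = K ** transpose B"
      by (simp add: matrix_eq matrix_vector_mul_assoc[symmetric])
  qed
qed

lemma mat_le_in_hull:
  fixes A B :: "real ^ 'q ^ 'd"
  assumes "A \<preceq>\<^sub>M B"
  shows "A \<in> convex hull ((**) B ` {U. orthogonal_matrix U})"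
proof -
  obtain K where K: "\<And>y. norm (K *v y) \<le> norm y" "transpose A = K ** transpose B"
    using mat_le_factor_contraction[OF assms] by blast
  have A: "A = B ** transpose K"
    by (metis K(2) matrix_transpose_mul transpose_transpose)
  have lin: "linear (\<lambda>U :: real ^ 'q ^ 'q. B ** transpose U)"
    by (rule linearI) (auto simp: matrix_matrix_mult_def transpose_def vec_eq_iff sum.distrib algebra_simps sum_distrib_left)
  have "A \<in> (\<lambda>U. B ** transpose U) ` (convex hull {U. orthogonal_matrix U})"
    using contraction_in_hull_orthogonal[OF K(1)] A by blast
  also have "\<dots> = convex hull ((\<lambda>U. B ** transpose U) ` {U. orthogonal_matrix U})"
    by (rule convex_hull_linear_image[OF lin])
  also have "\<dots> \<subseteq> convex hull ((**) B ` {U. orthogonal_matrix U})"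
    by (intro hull_mono) auto
  finally show ?thesis .
qed

section \<open>Gaussian integrals\<close>

text \<open>The image measure is again translation invariant because f is linear and bijective, so
  it is a multiple of Lebesgue measure. The factor is 1 because f preserves balls about 0.\<close>

lemma lborel_distr_isometry:
  fixes f :: "'a::euclidean_space \<Rightarrow> 'a"
  assumes f: "orthogonal_transformation f"
  shows "distr lborel borel f = lborel"
proof (rule measure_eqI)
  have lin: "linear f" and nrm: "\<And>x. norm (f x) = norm x"
    using f by (auto simp: orthogonal_transformation)
  have [measurable]: "f \<in> borel_measurable borel"
    using lin by (intro borel_measurable_continuous_onI linear_continuous_on linear_linear[THEN iffD2])
  have trans_lborel: "(\<integral>\<^sup>+ x. g (x + y) \<partial>lborel) = (\<integral>\<^sup>+ x. g x \<partial>lborel)"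
    if [measurable]: "g \<in> borel_measurable borel" for g :: "'a \<Rightarrow> ennreal" and y
  proof -
    have "(\<integral>\<^sup>+ x. g x \<partial>lborel) = (\<integral>\<^sup>+ x. g x \<partial>distr lborel borel ((+) y))"
      by (simp add: lborel_distr_plus)
    also have "\<dots> = (\<integral>\<^sup>+ x. g (x + y) \<partial>lborel)"
      by (simp add: nn_integral_distr add.commute)
    finally show ?thesis ..
  qed
  define N where "N = distr lborel borel f"
  have [simp, measurable_cong]: "sets N = sets borel"
    by (simp add: N_def)
  have "bij f"
    using f by (rule orthogonal_transformation_bij)
  then have f_inv: "f (inv f y) = y" for y
    by (simp add: bij_is_surj surj_f_inv_f)
  have trans_N: "(\<integral>\<^sup>+ y. g (y + x) \<partial>N) = (\<integral>\<^sup>+ y. g y \<partial>N)"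
    if [measurable]: "g \<in> borel_measurable borel" for g :: "'a \<Rightarrow> ennreal" and x
  proof -
    have "(\<integral>\<^sup>+ y. g (y + x) \<partial>N) = (\<integral>\<^sup>+ y. g (f (y + inv f x)) \<partial>lborel)"
      unfolding N_def by (subst nn_integral_distr) (auto simp: linear_add[OF lin] f_inv)
    also have "\<dots> = (\<integral>\<^sup>+ y. g (f y) \<partial>lborel)"
      by (rule trans_lborel) measurable
    also have "\<dots> = (\<integral>\<^sup>+ y. g y \<partial>N)"
      unfolding N_def by (subst nn_integral_distr) auto
    finally show ?thesis .
  qed
  have ball_N: "emeasure N (ball 0 r) = emeasure lborel (ball (0::'a) r)" for r
  proof -
    have "f -` ball 0 r = ball 0 r" by (auto simp: nrm)
    then show ?thesis by (simp add: N_def emeasure_distr)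
  qed
  \<comment> \<open>Needed for exchanging the order of integration below; the balls about 0 exhaust
    the space and have the same finite mass as under Lebesgue measure.\<close>
  have "sigma_finite_measure N"
  proof
    show "\<exists>A. countable A \<and> A \<subseteq> sets N \<and> \<Union> A = space N \<and> (\<forall>a\<in>A. emeasure N a \<noteq> \<infinity>)"
    proof (intro exI conjI ballI)
      show "countable (range (\<lambda>n. ball (0::'a) (real n)))" by simp
      show "range (\<lambda>n. ball (0::'a) (real n)) \<subseteq> sets N" by auto
      have "(\<Union>n. ball (0::'a) (real n)) = UNIV"
        by (auto simp: reals_Archimedean2)
      then show "\<Union> (range (\<lambda>n. ball (0::'a) (real n))) = space N" by (simp add: N_def)
      show "emeasure N a \<noteq> \<infinity>" if "a \<in> range (\<lambda>n. ball (0::'a) (real n))" for a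
        using that emeasure_lborel_ball_finite[of "0::'a"] by (auto simp: ball_N less_top)
    qed
  qed
  then interpret pair_sigma_finite N lborel
    by (simp add: pair_sigma_finite_def sigma_finite_lborel)
  show "sets (distr lborel borel f) = sets lborel" by simp
  fix A :: "'a set" assume "A \<in> sets (distr lborel borel f)"
  then have [measurable]: "A \<in> sets borel" by simp
  \<comment> \<open>Uniqueness of translation-invariant measures: evaluate the double integral of
    \<open>1_A(x) 1_B(y - x)\<close>, with \<open>B\<close> the unit ball, in both orders.\<close>
  let ?B = "ball (0::'a) 1"
  have [measurable]: "?B \<in> sets borel" by simp
  let ?g = "\<lambda>x y. indicator A x * indicator ?B (y - x) :: ennreal"
  have "emeasure lborel A * emeasure N ?B = (\<integral>\<^sup>+ x. indicator A x * (\<integral>\<^sup>+ y. indicator ?B (y + - x) \<partial>N) \<partial>lborel)"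
    unfolding trans_N[OF borel_measurable_indicator[OF borel_open[OF open_ball]]] by (simp add: nn_integral_multc)
  also have "\<dots> = (\<integral>\<^sup>+ x. (\<integral>\<^sup>+ y. ?g x y \<partial>N) \<partial>lborel)"
    unfolding add_uminus_conv_diff by (intro nn_integral_cong nn_integral_cmult[symmetric]) measurable
  also have "\<dots> = (\<integral>\<^sup>+ y. (\<integral>\<^sup>+ x. ?g x y \<partial>lborel) \<partial>N)"
    by (rule Fubini') measurable
  also have "\<dots> = (\<integral>\<^sup>+ y. (\<integral>\<^sup>+ x. ?g (x + y) y \<partial>lborel) \<partial>N)"
    by (subst trans_lborel) auto
  also have "\<dots> = (\<integral>\<^sup>+ y. (\<integral>\<^sup>+ x. indicator A (y + x) * indicator ?B x \<partial>lborel) \<partial>N)"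
    by (simp add: indicator_def add.commute)
  also have "\<dots> = (\<integral>\<^sup>+ x. (\<integral>\<^sup>+ y. indicator A (y + x) * indicator ?B x \<partial>N) \<partial>lborel)"
    by (rule Fubini'[symmetric]) measurable
  also have "\<dots> = (\<integral>\<^sup>+ x. (\<integral>\<^sup>+ y. indicator A (y + x) \<partial>N) * indicator ?B x \<partial>lborel)"
    by (simp add: nn_integral_multc)
  also have "\<dots> = (\<integral>\<^sup>+ x. emeasure N A * indicator ?B x \<partial>lborel)"
    by (subst trans_N) auto
  also have "\<dots> = emeasure N A * emeasure lborel ?B"
    by (simp add: nn_integral_cmult)
  finally have eq: "emeasure lborel A * emeasure lborel ?B = emeasure N A * emeasure lborel ?B"
    by (simp add: ball_N)
  have "emeasure lborel ?B \<noteq> 0"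
    using content_ball_pos[of 1 "0::'a"] by (auto simp: measure_def)
  moreover have "emeasure lborel ?B \<noteq> \<infinity>"
    using emeasure_lborel_ball_finite[of "0::'a" 1] by simp
  ultimately have "emeasure lborel A = emeasure N A"
    using eq ennreal_mult_cancel_left[of "emeasure lborel ?B"] by (auto simp: mult.commute)
  then show "emeasure (distr lborel borel f) A = emeasure lborel A"
    by (simp add: N_def)
qed

section \<open>The standard Gaussian law: rotations, total mass and moments\<close>

definition gauss :: "(real ^ 'q) measure" where
  "gauss = density lborel (\<lambda>z. ennreal (std_gaussian_density z))"

lemma sets_gauss [simp, measurable_cong]: "sets gauss = sets borel"
  and space_gauss [simp]: "space gauss = UNIV"
  by (auto simp: gauss_def)

lemma std_gaussian_density_measurable [measurable]: "std_gaussian_density \<in> borel_measurable borel"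
  unfolding std_gaussian_density_def by measurable

lemma std_gaussian_density_nonneg [simp]: "0 \<le> std_gaussian_density z"
  by (simp add: std_gaussian_density_def)

lemma matrix_vector_mult_measurable [measurable]:
  "(*v) A \<in> borel_measurable borel" for A :: "real ^ 'm ^ 'n"
  by (intro borel_measurable_continuous_onI linear_continuous_on linear_linear[THEN iffD2] matrix_vector_mul_linear)

lemma gauss_distr_orthogonal:
  assumes "orthogonal_matrix U"
  shows "distr gauss borel ((*v) U) = gauss"
proof -
  have U: "orthogonal_transformation ((*v) U)"
    using assms by (simp add: orthogonal_transformation_matrix)
  then have nrm: "norm (U *v z) = norm z" for z
    by (simp add: orthogonal_transformation)
  have "density (distr lborel borel ((*v) U)) (\<lambda>z. ennreal (std_gaussian_density z))
      = distr (density lborel (\<lambda>z. ennreal (std_gaussian_density (U *v z)))) borel ((*v) U)"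
    by (rule density_distr) measurable
  then show ?thesis
    by (simp add: gauss_def lborel_distr_isometry[OF U] std_gaussian_density_def nrm)
qed

text \<open>Times the exponential, the standard density becomes s^q times the density of a centred
  Gaussian with covariance s^2 I, which is a product of one-dimensional normal densities. The case s
  = 1 gives total mass 1; s = sqrt 2 gives the exponent |z|^2/4 that dominates all moments.\<close>

lemma nn_integral_exp_gauss:
  assumes s: "0 < s"
  shows "(\<integral>\<^sup>+ z. ennreal (exp ((1 - 1 / s\<^sup>2) * (norm z)\<^sup>2 / 2)) \<partial>(gauss :: (real ^ 'q) measure)) = ennreal s ^ CARD('q)"
proof -
  let ?f = "\<lambda>x. s * normal_density 0 s x"
  have eq: "exp ((1 - 1 / s\<^sup>2) * (norm z)\<^sup>2 / 2) * std_gaussian_density z = (\<Prod>b\<in>Basis. ?f (z \<bullet> b))" for z :: "real ^ 'q"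
  proof -
    have f: "?f x = (1 / sqrt (2 * pi)) * exp (- (x\<^sup>2 / (2 * s\<^sup>2)))" for x
      using s by (simp add: normal_density_def real_sqrt_mult)
    have n: "(norm z)\<^sup>2 = (\<Sum>b\<in>Basis. (z \<bullet> b)\<^sup>2)"
      by (subst power2_norm_eq_inner, subst euclidean_inner) (simp add: power2_eq_square)
    have "(\<Prod>b\<in>Basis. ?f (z \<bullet> b)) = (1 / sqrt (2 * pi)) ^ CARD('q) * exp (- ((norm z)\<^sup>2 / (2 * s\<^sup>2)))"
      unfolding f prod.distrib n sum_divide_distrib by (simp add: exp_sum[symmetric] sum_negf)
    also have "exp (- ((norm z)\<^sup>2 / (2 * s\<^sup>2))) = exp ((1 - 1 / s\<^sup>2) * (norm z)\<^sup>2 / 2) * exp (- (norm z)\<^sup>2 / 2)"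
      unfolding exp_add[symmetric] by (rule arg_cong[of _ _ exp]) (simp add: field_simps)
    also have "(1 / sqrt (2 * pi)) ^ CARD('q) * \<dots> = exp ((1 - 1 / s\<^sup>2) * (norm z)\<^sup>2 / 2) * std_gaussian_density z"
      by (simp only: std_gaussian_density_def real_sqrt_power power_one_over mult_1 divide_inverse power_inverse mult_ac)
    finally show ?thesis ..
  qed
  interpret nd: prob_space "density lborel (normal_density 0 s)"
    using s by (rule prob_space_normal_density)
  have "(\<integral>\<^sup>+ x. ennreal (normal_density 0 s x) \<partial>lborel) = 1"
    using nd.emeasure_space_1 by (simp add: emeasure_density)
  then have one: "(\<integral>\<^sup>+ x. ennreal (?f x) \<partial>lborel) = ennreal s"
    using s by (simp add: ennreal_mult nn_integral_cmult)
  have "(\<integral>\<^sup>+ z. ennreal (exp ((1 - 1 / s\<^sup>2) * (norm z)\<^sup>2 / 2)) \<partial>(gauss :: (real ^ 'q) measure))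
      = (\<integral>\<^sup>+ z. ennreal (\<Prod>b\<in>Basis. ?f (z \<bullet> b)) \<partial>(lborel :: (real ^ 'q) measure))"
    unfolding gauss_def by (subst nn_integral_density) (auto simp: eq[symmetric] ennreal_mult mult.commute)
  also have "\<dots> = (\<integral>\<^sup>+ z. (\<Prod>b\<in>Basis. ennreal (?f (z \<bullet> b))) \<partial>(lborel :: (real ^ 'q) measure))"
    using s by (simp add: prod_ennreal)
  also have "\<dots> = (\<Prod>b\<in>(Basis :: (real ^ 'q) set). (\<integral>\<^sup>+ x. ennreal (?f x) \<partial>lborel))"
    using s by (intro nn_integral_lborel_prod) auto
  also have "\<dots> = ennreal s ^ CARD('q)"
    unfolding one by simp
  finally show ?thesis .
qed

lemma prob_space_gauss: "prob_space (gauss :: (real ^ 'q) measure)"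
  using nn_integral_exp_gauss[where s = 1 and 'q = 'q] by (intro prob_spaceI) simp

lemma powr_le_exp_square:
  fixes p :: real
  assumes "0 \<le> p"
  shows "\<exists>C. \<forall>t\<ge>0. t powr p \<le> C * exp (t\<^sup>2 / 4)"
proof -
  obtain n :: nat where n: "p \<le> real n"
    using real_arch_simple by blast
  \<comment> \<open>The summand 1 covers t \<le> 1. For t > 1 the power is at most t^(2n), which is
    4^n n! times the n-th term of the exponential series at t^2/4.\<close>
  have "t powr p \<le> (1 + 4 ^ n * fact n) * exp (t\<^sup>2 / 4)" if t: "0 \<le> t" for t :: real
  proof (cases "t \<le> 1")
    case True
    then have "t powr p \<le> 1"
      using assms t powr_mono2[of p t 1] by simp
    also have "1 \<le> (1 + 4 ^ n * fact n :: real)"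
      by simp
    also have "\<dots> \<le> (1 + 4 ^ n * fact n) * exp (t\<^sup>2 / 4)"
      using mult_left_mono[of 1 "exp (t\<^sup>2 / 4)" "1 + 4 ^ n * fact n"] by simp
    finally show ?thesis .
  next
    case False
    then have "t powr p \<le> t powr real (2 * n)"
      using n by (intro powr_mono) auto
    also have "\<dots> = t ^ (2 * n)"
      using False by (intro powr_realpow) simp
    also have "\<dots> = 4 ^ n * fact n * ((t\<^sup>2 / 4) ^ n / fact n)"
      by (simp add: power_divide power_mult)
    also have "\<dots> \<le> 4 ^ n * fact n * exp (t\<^sup>2 / 4)"
    proof (rule mult_left_mono)
      have "(\<Sum>i\<in>{n}. (t\<^sup>2 / 4) ^ i /\<^sub>R fact i) \<le> (\<Sum>i. (t\<^sup>2 / 4) ^ i /\<^sub>R fact i)"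
        by (rule sum_le_suminf[OF summable_exp_generic]) auto
      also have "\<dots> = exp (t\<^sup>2 / 4)"
        by (simp only: exp_def)
      finally show "(t\<^sup>2 / 4) ^ n / fact n \<le> exp (t\<^sup>2 / 4)"
        by (simp only: sum.insert sum.empty finite.emptyI empty_iff not_False_eq_True add_0_right real_scaleR_def divide_inverse mult.commute[of "inverse _"])
    qed simp
    also have "\<dots> \<le> (1 + 4 ^ n * fact n) * exp (t\<^sup>2 / 4)"
      by (simp add: mult_le_cancel_right)
    finally show ?thesis .
  qed
  then show ?thesis by blast
qed

lemma integrable_norm_powr_gauss:
  assumes "0 \<le> p"
  shows "integrable (gauss :: (real ^ 'q) measure) (\<lambda>z. norm z powr p)"
proof -
  obtain C where C: "\<And>t. t \<ge> 0 \<Longrightarrow> t powr p \<le> C * exp (t\<^sup>2 / 4)"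
    using powr_le_exp_square[OF assms] by blast
  have "(\<integral>\<^sup>+ z. ennreal (exp ((norm z)\<^sup>2 / 4)) \<partial>(gauss :: (real ^ 'q) measure)) = ennreal (sqrt 2) ^ CARD('q)"
    using nn_integral_exp_gauss[of "sqrt 2"] by simp
  then have "integrable (gauss :: (real ^ 'q) measure) (\<lambda>z. exp ((norm z)\<^sup>2 / 4))"
    by (intro integrableI_nonneg) (auto simp: ennreal_power)
  then have "integrable (gauss :: (real ^ 'q) measure) (\<lambda>z. C * exp ((norm z)\<^sup>2 / 4))"
    by simp
  then show ?thesis
    by (rule Bochner_Integration.integrable_bound) (auto intro!: AE_I2 order_trans[OF C] simp: abs_mult)
qed

lemma integrable_norm_gauss: "integrable (gauss :: (real ^ 'q) measure) norm"
  using integrable_norm_powr_gauss[of 1] by simp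

lemma lipschitz_on_borel_measurable:
  "C-lipschitz_on UNIV f \<Longrightarrow> f \<in> borel_measurable borel"
  by (intro borel_measurable_continuous_onI lipschitz_on_continuous_on)

lemma integrable_gauss_lipschitz:
  fixes A :: "real ^ 'q ^ 'd" and f :: "real ^ 'd \<Rightarrow> real"
  assumes lip: "C-lipschitz_on UNIV f"
  shows "integrable gauss (\<lambda>z. f (c + A *v z))"
proof -
  interpret prob_space "gauss :: (real ^ 'q) measure" by (rule prob_space_gauss)
  have [measurable]: "f \<in> borel_measurable borel"
    using lip by (rule lipschitz_on_borel_measurable)
  have "integrable gauss (\<lambda>z :: real ^ 'q. \<bar>f c\<bar> + C * (onorm ((*v) A) * norm z))"
    using integrable_norm_gauss by (intro Bochner_Integration.integrable_add integrable_mult_right) auto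
  then show ?thesis
  proof (rule Bochner_Integration.integrable_bound)
    have "norm (f (c + A *v z)) \<le> \<bar>f c\<bar> + C * (onorm ((*v) A) * norm z)" for z
    proof -
      have "\<bar>f (c + A *v z) - f c\<bar> \<le> C * norm (A *v z)"
        using lipschitz_onD[OF lip, of "c + A *v z" c] by (simp add: dist_norm)
      also have "\<dots> \<le> C * (onorm ((*v) A) * norm z)"
        using lipschitz_on_nonneg[OF lip]
        by (intro mult_left_mono onorm) (auto simp: linear_linear)
      finally show ?thesis by simp
    qed
    then show "AE z in gauss. norm (f (c + A *v z)) \<le> norm (\<bar>f c\<bar> + C * (onorm ((*v) A) * norm z))"
      by (intro AE_I2) (metis order_trans abs_ge_self real_norm_def)
  qed measurable
qed

lemma gauss_mono_mat_le:
  fixes A B :: "real ^ 'q ^ 'd" and f :: "real ^ 'd \<Rightarrow> real"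
  assumes lip: "C-lipschitz_on UNIV f" and cvx: "convex_on UNIV f" and le: "A \<preceq>\<^sub>M B"
  shows "(\<integral>z. f (c + A *v z) \<partial>gauss) \<le> (\<integral>z. f (c + B *v z) \<partial>gauss)"
proof -
  define F where "F A = (\<integral>z. f (c + A *v z) \<partial>gauss)" for A :: "real ^ 'q ^ 'd"
  note int = integrable_gauss_lipschitz[OF lip]
  have [measurable]: "f \<in> borel_measurable borel"
    using lip by (rule lipschitz_on_borel_measurable)
  have "convex_on UNIV F"
  proof (intro convex_onI)
    fix t :: real and A B :: "real ^ 'q ^ 'd" assume t: "0 < t" "t < 1"
    have "F ((1 - t) *\<^sub>R A + t *\<^sub>R B) \<le> (\<integral>z. (1 - t) * f (c + A *v z) + t * f (c + B *v z) \<partial>gauss)"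
      unfolding F_def
    proof (intro integral_mono int Bochner_Integration.integrable_add integrable_mult_right)
      fix z
      have "c + ((1 - t) *\<^sub>R A + t *\<^sub>R B) *v z = (1 - t) *\<^sub>R (c + A *v z) + t *\<^sub>R (c + B *v z)"
        by (simp add: matrix_vector_mult_add_rdistrib scaleR_matrix_vector_assoc[symmetric] algebra_simps)
      then show "f (c + ((1 - t) *\<^sub>R A + t *\<^sub>R B) *v z) \<le> (1 - t) * f (c + A *v z) + t * f (c + B *v z)"
        using convex_onD[OF cvx, of t "c + A *v z" "c + B *v z"] t by simp
    qed
    also have "\<dots> = (1 - t) * F A + t * F B"
      unfolding F_def by (simp add: int)
    finally show "F ((1 - t) *\<^sub>R A + t *\<^sub>R B) \<le> (1 - t) * F A + t * F B" .
  qed simp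
  then have "convex_on (convex hull ((**) B ` {U. orthogonal_matrix U})) F"
    by (rule convex_on_subset) (auto intro: convex_convex_hull)
  moreover have "F (B ** U) = F B" if "orthogonal_matrix U" for U
  proof -
    have "F (B ** U) = (\<integral>z. f (c + B *v z) \<partial>(distr gauss borel ((*v) U)))"
      unfolding F_def by (subst integral_distr) (auto simp: matrix_vector_mul_assoc)
    then show ?thesis
      by (simp add: gauss_distr_orthogonal[OF that] F_def)
  qed
  ultimately have "F A \<le> F B"
    using convex_on_convex_hull_bound[of "(**) B ` {U. orthogonal_matrix U}" F "F B"] mat_le_in_hull[OF le] by auto
  then show ?thesis by (simp add: F_def)
qed

section \<open>Lipschitz test functions for the convex order\<close>

text \<open>A hyperplane separating (x, f x) from the epigraph is the graph of the tangent. The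
  strict epigraph is used because it does not contain the point itself.\<close>

lemma convex_on_subgradient:
  fixes f :: "'a::euclidean_space \<Rightarrow> real"
  assumes cvx: "convex_on UNIV f"
  obtains a where "\<And>y. f x + a \<bullet> (y - x) \<le> f y"
proof -
  define S where "S = {(y, t). f y < t}"
  have "convex S"
  proof (rule convexI)
    fix u v :: "'a \<times> real" and \<alpha> \<beta> :: real
    assume *: "u \<in> S" "v \<in> S" "0 \<le> \<alpha>" "0 \<le> \<beta>" "\<alpha> + \<beta> = 1"
    have "f (\<alpha> *\<^sub>R fst u + \<beta> *\<^sub>R fst v) \<le> \<alpha> * f (fst u) + \<beta> * f (fst v)"
      using cvx * unfolding convex_on_def by simp
    also have "\<dots> < \<alpha> * snd u + \<beta> * snd v"
    proof (cases "\<alpha> = 0")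
      case False
      then have "\<alpha> * f (fst u) < \<alpha> * snd u" "\<beta> * f (fst v) \<le> \<beta> * snd v"
        using * by (auto simp: S_def intro!: mult_left_mono)
      then show ?thesis by simp
    qed (use * in \<open>auto simp: S_def\<close>)
    finally show "\<alpha> *\<^sub>R u + \<beta> *\<^sub>R v \<in> S"
      by (simp add: S_def case_prod_beta)
  qed
  moreover have "(0, f 0 + 1) \<in> S" "(x, f x) \<notin> S"
    by (auto simp: S_def)
  ultimately
  obtain c d where c: "c \<noteq> 0" and sep: "\<And>u. u \<in> S \<Longrightarrow> d \<le> c \<bullet> u" and d: "c \<bullet> (x, f x) \<le> d"
  proof -
    have "\<exists>c d. c \<noteq> 0 \<and> (\<forall>u\<in>{(x, f x)}. c \<bullet> u \<le> d) \<and> (\<forall>u\<in>S. d \<le> c \<bullet> u)"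
      using \<open>convex S\<close> \<open>(0, f 0 + 1) \<in> S\<close> \<open>(x, f x) \<notin> S\<close> by (intro separating_hyperplane_sets) auto
    then show ?thesis using that by blast
  qed
  obtain a s where cs: "c = (a, s)" by (cases c)
  have sep': "a \<bullet> x + s * f x \<le> a \<bullet> y + s * t" if "f y < t" for y t
    using sep[of "(y, t)"] d that by (auto simp: S_def cs)
  have "s \<ge> 0"
  proof (rule ccontr)
    assume "\<not> s \<ge> 0"
    then show False
      using sep'[of x "f x + 1"] by (simp add: algebra_simps)
  qed
  \<comment> \<open>A vertical hyperplane is impossible since f is finite everywhere: the epigraph
    lies above every point, in particular above x - a.\<close>
  moreover have "s \<noteq> 0"
  proof
    assume "s = 0"
    then have "a \<bullet> a \<le> 0"
      using sep'[of "x - a" "f (x - a) + 1"] by (simp add: inner_diff_right)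
    then have "a = 0"
      by (metis inner_gt_zero_iff linorder_not_less)
    then show False using c cs \<open>s = 0\<close> by (simp add: zero_prod_def)
  qed
  ultimately have s: "s > 0" by simp
  \<comment> \<open>Points of the graph are not in the strict epigraph, so the inequality there is a
    limit from above.\<close>
  have le: "a \<bullet> x + s * f x \<le> a \<bullet> y + s * f y" for y
  proof (rule field_le_epsilon)
    fix e :: real assume "e > 0"
    then show "a \<bullet> x + s * f x \<le> a \<bullet> y + s * f y + e"
      using sep'[of y "f y + e / s"] s by (simp add: algebra_simps)
  qed
  show ?thesis
  proof
    show "f x + ((- 1 / s) *\<^sub>R a) \<bullet> (y - x) \<le> f y" for y
      using le[of y] s by (simp add: field_simps inner_diff_right)
  qed
qed

section \<open>Lipschitz approximation of convex functions from below\<close>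

definition affine_minorants :: "('a::euclidean_space \<Rightarrow> real) \<Rightarrow> real \<Rightarrow> ('a \<times> real) set" where
  "affine_minorants f C = {(a, c). norm a \<le> C \<and> (\<forall>y. a \<bullet> y + c \<le> f y)}"

text \<open>Where \<open>f\<close> has a subgradient of norm at most \<open>C\<close>, this equals \<open>f\<close>. Without affine minorants of slope
  at most \<open>C\<close> it is the junk supremum of the empty set.\<close>

definition lipschitz_envelope :: "('a::euclidean_space \<Rightarrow> real) \<Rightarrow> real \<Rightarrow> 'a \<Rightarrow> real" where
  "lipschitz_envelope f C x = (SUP (a, c)\<in>affine_minorants f C. a \<bullet> x + c)"

lemma affine_minorants_mono: "C \<le> D \<Longrightarrow> affine_minorants f C \<subseteq> affine_minorants f D"
  by (auto simp: affine_minorants_def)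

lemma lipschitz_envelope_ge:
  "(a, c) \<in> affine_minorants f C \<Longrightarrow> a \<bullet> x + c \<le> lipschitz_envelope f C x"
  unfolding lipschitz_envelope_def
  by (rule cSUP_upper2[where x = "(a, c)"]) (auto intro!: bdd_aboveI[of _ "f x"] simp: affine_minorants_def)

lemma lipschitz_envelope_least:
  assumes "affine_minorants f C \<noteq> {}" "\<And>a c. (a, c) \<in> affine_minorants f C \<Longrightarrow> a \<bullet> x + c \<le> r"
  shows "lipschitz_envelope f C x \<le> r"
  unfolding lipschitz_envelope_def using assms by (intro cSUP_least) auto

lemma lipschitz_envelope_le:
  "affine_minorants f C \<noteq> {} \<Longrightarrow> lipschitz_envelope f C x \<le> f x"
  by (rule lipschitz_envelope_least) (auto simp: affine_minorants_def)

lemma lipschitz_envelope_mono: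
  "affine_minorants f C \<noteq> {} \<Longrightarrow> C \<le> D \<Longrightarrow> lipschitz_envelope f C x \<le> lipschitz_envelope f D x"
  by (rule lipschitz_envelope_least) (auto intro: lipschitz_envelope_ge affine_minorants_mono[THEN subsetD])

lemma lipschitz_on_envelope:
  assumes ne: "affine_minorants f C \<noteq> {}"
  shows "C-lipschitz_on UNIV (lipschitz_envelope f C)"
proof (rule lipschitz_onI)
  show "0 \<le> C"
    using ne by (auto simp: affine_minorants_def intro: order_trans[OF norm_ge_zero])
  have le: "lipschitz_envelope f C x \<le> lipschitz_envelope f C y + C * dist x y" for x y
  proof (rule lipschitz_envelope_least[OF ne])
    fix a c assume ac: "(a, c) \<in> affine_minorants f C"
    have "a \<bullet> x + c = (a \<bullet> y + c) + a \<bullet> (x - y)"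
      by (simp add: inner_diff_right)
    also have "\<dots> \<le> lipschitz_envelope f C y + C * dist x y"
    proof (rule add_mono[OF lipschitz_envelope_ge[OF ac]])
      have "a \<bullet> (x - y) \<le> norm a * norm (x - y)"
        by (rule norm_cauchy_schwarz)
      also have "\<dots> \<le> C * dist x y"
        using ac by (auto simp: affine_minorants_def dist_norm intro!: mult_right_mono)
      finally show "a \<bullet> (x - y) \<le> C * dist x y" .
    qed
    finally show "a \<bullet> x + c \<le> lipschitz_envelope f C y + C * dist x y" .
  qed
  show "dist (lipschitz_envelope f C x) (lipschitz_envelope f C y) \<le> C * dist x y" for x y
    using le[of x y] le[of y x] by (simp add: dist_real_def dist_commute abs_le_iff)
qed

lemma convex_on_envelope:
  assumes ne: "affine_minorants f C \<noteq> {}"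
  shows "convex_on UNIV (lipschitz_envelope f C)"
proof (rule convex_onI)
  fix t :: real and x y assume t: "0 < t" "t < 1"
  show "lipschitz_envelope f C ((1 - t) *\<^sub>R x + t *\<^sub>R y)
      \<le> (1 - t) * lipschitz_envelope f C x + t * lipschitz_envelope f C y"
  proof (rule lipschitz_envelope_least[OF ne])
    fix a c assume ac: "(a, c) \<in> affine_minorants f C"
    have "a \<bullet> ((1 - t) *\<^sub>R x + t *\<^sub>R y) + c = (1 - t) * (a \<bullet> x + c) + t * (a \<bullet> y + c)"
      by (simp add: inner_add_right algebra_simps)
    also have "\<dots> \<le> (1 - t) * lipschitz_envelope f C x + t * lipschitz_envelope f C y"
      using t by (intro add_mono mult_left_mono lipschitz_envelope_ge[OF ac]) auto
    finally show "a \<bullet> ((1 - t) *\<^sub>R x + t *\<^sub>R y) + c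
      \<le> (1 - t) * lipschitz_envelope f C x + t * lipschitz_envelope f C y" .
  qed
qed simp

text \<open>A tangent at x of slope at most C is itself one of the competing minorants, and it
  touches f at x.\<close>

lemma lipschitz_envelope_eq:
  assumes "\<And>y. f x + a \<bullet> (y - x) \<le> f y" "norm a \<le> C"
  shows "lipschitz_envelope f C x = f x"
proof (rule antisym)
  have ac: "(a, f x - a \<bullet> x) \<in> affine_minorants f C"
    using assms by (auto simp: affine_minorants_def inner_diff_right algebra_simps)
  show "lipschitz_envelope f C x \<le> f x"
    using ac by (intro lipschitz_envelope_le) auto
  show "f x \<le> lipschitz_envelope f C x"
    using lipschitz_envelope_ge[OF ac, of x] by simp
qed

lemma integrable_lipschitz:
  assumes \<mu>: "\<mu> \<in> prob_dists 1" and lip: "C-lipschitz_on UNIV f"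
  shows "integrable \<mu> (f :: real ^ 'd \<Rightarrow> real)"
proof -
  interpret prob_space \<mu> using \<mu> by (simp add: prob_dists_def)
  have [measurable_cong]: "sets \<mu> = sets borel"
    using \<mu> by (simp add: prob_dists_def)
  have [measurable]: "f \<in> borel_measurable borel"
    using lip by (rule lipschitz_on_borel_measurable)
  have "integrable \<mu> (\<lambda>x. \<bar>f 0\<bar> + C * norm x)"
    using \<mu> by (simp add: prob_dists_def)
  then show ?thesis
  proof (rule Bochner_Integration.integrable_bound)
    have "norm (f x) \<le> \<bar>f 0\<bar> + C * norm x" for x
      using lipschitz_onD[OF lip, of x 0] by (simp add: dist_norm)
    then show "AE x in \<mu>. norm (f x) \<le> norm (\<bar>f 0\<bar> + C * norm x)"
      by (intro AE_I2) (metis order_trans abs_ge_self real_norm_def)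
  qed measurable
qed

section \<open>Extended integrals and reduction to Lipschitz test functions\<close>

lemma ext_integral_eq_integral:
  assumes "integrable \<mu> f"
  shows "ext_integral \<mu> f = ereal (\<integral>x. f x \<partial>\<mu>)"
proof -
  have "(\<integral>\<^sup>+ x. ennreal (f x) \<partial>\<mu>) < \<infinity>" "(\<integral>\<^sup>+ x. ennreal (- f x) \<partial>\<mu>) < \<infinity>"
    using assms by (auto simp: real_integrable_def less_top)
  then show ?thesis
    unfolding ext_integral_def real_lebesgue_integral_def[OF assms]
    by (cases "\<integral>\<^sup>+ x. ennreal (f x) \<partial>\<mu>"; cases "\<integral>\<^sup>+ x. ennreal (- f x) \<partial>\<mu>")
      (auto simp: enn2ereal_ennreal)
qed

lemma cv_leD_integral:
  assumes "\<mu> \<preceq>\<^sub>c\<^sub>v \<nu>" "convex_on UNIV f" "integrable \<mu> f" "integrable \<nu> f"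
  shows "(\<integral>x. f x \<partial>\<mu>) \<le> (\<integral>x. f x \<partial>\<nu>)"
proof -
  have "ext_integral \<mu> f \<le> ext_integral \<nu> f"
    using assms by (simp add: cv_le_def)
  then show ?thesis
    by (simp add: ext_integral_eq_integral assms)
qed

text \<open>Splits off an integrable minorant, so that a possibly infinite value sits in the
  integral of the nonnegative function f - g alone, where monotone convergence applies.\<close>

lemma ext_integral_eq_minorant:
  assumes [measurable]: "f \<in> borel_measurable \<mu>" and g: "integrable \<mu> g" and le: "\<And>x. g x \<le> f x"
  shows "ext_integral \<mu> f = enn2ereal (\<integral>\<^sup>+ x. ennreal (f x - g x) \<partial>\<mu>) + ereal (\<integral>x. g x \<partial>\<mu>)"
proof -
  have [measurable]: "g \<in> borel_measurable \<mu>" using g by auto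
  let ?I = "\<lambda>h. \<integral>\<^sup>+ x. ennreal (h x) \<partial>\<mu>"
  \<comment> \<open>Since \<open>ennreal\<close> sends negative numbers to 0, the terms are positive
    and negative parts. The relation f = (f - g) + g is arranged so that nonnegative functions are
    only added; finite terms are cancelled after integration.\<close>
  have "?I (\<lambda>x. f x - g x) + ?I g + ?I (\<lambda>x. - f x)
      = (\<integral>\<^sup>+ x. ennreal (f x - g x) + ennreal (g x) + ennreal (- f x) \<partial>\<mu>)"
    by (simp add: nn_integral_add)
  also have "\<dots> = (\<integral>\<^sup>+ x. ennreal (f x) + ennreal (- g x) \<partial>\<mu>)"
  proof (rule nn_integral_cong)
    fix x
    have "ennreal (f x - g x) + ennreal (g x) + ennreal (- f x) = ennreal ((f x - g x) + max 0 (g x) + max 0 (- f x))"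
      using le[of x] by (subst (2 3) ennreal_max_0[symmetric]) (simp add: ennreal_plus[symmetric] del: ennreal_plus ennreal_max_0)
    also have "(f x - g x) + max 0 (g x) + max 0 (- f x) = max 0 (f x) + max 0 (- g x)"
      using le[of x] by auto
    also have "ennreal \<dots> = ennreal (f x) + ennreal (- g x)"
      by (subst ennreal_plus) (auto simp: ennreal_max_0)
    finally show "ennreal (f x - g x) + ennreal (g x) + ennreal (- f x) = ennreal (f x) + ennreal (- g x)" .
  qed
  also have "\<dots> = ?I f + ?I (\<lambda>x. - g x)"
    by (simp add: nn_integral_add)
  finally have eq: "?I (\<lambda>x. f x - g x) + ?I g + ?I (\<lambda>x. - f x) = ?I f + ?I (\<lambda>x. - g x)" .
  have fin: "?I g < \<infinity>" "?I (\<lambda>x. - g x) < \<infinity>"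
    using g by (auto simp: real_integrable_def less_top)
  have "?I (\<lambda>x. - f x) \<le> ?I (\<lambda>x. - g x)"
    by (intro nn_integral_mono ennreal_leI) (use le in auto)
  then have fin2: "?I (\<lambda>x. - f x) < \<infinity>"
    using fin(2) by (rule le_less_trans)
  obtain a where a: "a \<ge> 0" "?I g = ennreal a"
    using fin(1) by (cases "?I g") auto
  obtain b where b: "b \<ge> 0" "?I (\<lambda>x. - g x) = ennreal b"
    using fin(2) by (cases "?I (\<lambda>x. - g x)") auto
  obtain c where c: "c \<ge> 0" "?I (\<lambda>x. - f x) = ennreal c"
    using fin2 by (cases "?I (\<lambda>x. - f x)") auto
  have int: "(\<integral>x. g x \<partial>\<mu>) = a - b"
    unfolding real_lebesgue_integral_def[OF g] a b by (simp add: a b)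
  show ?thesis
  proof (cases "?I f")
    case (real d)
    then have "?I (\<lambda>x. f x - g x) \<noteq> \<infinity>"
      using eq b by (auto simp: ennreal_plus[symmetric] simp del: ennreal_plus)
    then obtain e where e: "e \<ge> 0" "?I (\<lambda>x. f x - g x) = ennreal e"
      by (cases "?I (\<lambda>x. f x - g x)") auto
    have "e + a + c = d + b"
      using eq real a b c e by (simp add: ennreal_plus[symmetric] del: ennreal_plus)
    then show ?thesis
      using real a b c e by (simp add: ext_integral_def int enn2ereal_ennreal)
  next
    case top
    then have "?I (\<lambda>x. f x - g x) = \<infinity>"
      using eq a c by (auto simp: ennreal_add_eq_top)
    then show ?thesis
      using top c by (simp add: ext_integral_def int enn2ereal_ennreal)
  qed
qed

text \<open>A convex f is the increasing limit of its Lipschitz envelopes: at each point the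
  sequence equals f as soon as the allowed slope exceeds that of a tangent there. Subtracting the
  tangent g at 0 makes the functions nonnegative, as monotone convergence requires.\<close>

lemma cv_leI_lipschitz:
  fixes \<mu> \<nu> :: "(real ^ 'd) measure"
  assumes \<mu>: "\<mu> \<in> prob_dists 1" and \<nu>: "\<nu> \<in> prob_dists 1"
    and le: "\<And>C f. C-lipschitz_on UNIV f \<Longrightarrow> convex_on UNIV f \<Longrightarrow> (\<integral>x. f x \<partial>\<mu>) \<le> (\<integral>x. f x \<partial>\<nu>)"
  shows "\<mu> \<preceq>\<^sub>c\<^sub>v \<nu>"
  unfolding cv_le_def
proof (intro conjI allI impI \<mu> \<nu>)
  fix f :: "real ^ 'd \<Rightarrow> real" assume cvx: "convex_on UNIV f"
  have "continuous_on UNIV f"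
    using cvx by (intro convex_on_continuous) auto
  then have [measurable]: "f \<in> borel_measurable borel"
    by (rule borel_measurable_continuous_onI)
  have sets [measurable_cong, simp]: "sets \<mu> = sets borel" "sets \<nu> = sets borel"
    using \<mu> \<nu> by (auto simp: prob_dists_def)
  obtain a where a: "\<And>y. f 0 + a \<bullet> (y - 0) \<le> f y"
    using convex_on_subgradient[OF cvx] by metis
  define g where "g y = a \<bullet> y + f 0" for y
  have g_le: "g y \<le> f y" for y
    using a[of y] by (simp add: g_def)
  \<comment> \<open>The shift by k admits the tangent at 0 as a minorant for every n, so no envelope
    is a supremum over the empty set.\<close>
  obtain k :: nat where k: "norm a \<le> real k"
    using real_arch_simple by blast
  define F where "F n = lipschitz_envelope f (real (n + k))" for n
  have mem: "(a, f 0) \<in> affine_minorants f (real (n + k))" for n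
    using k g_le by (auto simp: affine_minorants_def g_def)
  then have ne: "affine_minorants f (real (n + k)) \<noteq> {}" for n by blast
  have g_le_F: "g y \<le> F n y" for n y
    unfolding g_def F_def by (rule lipschitz_envelope_ge[OF mem])
  have lip_F: "(real (n + k))-lipschitz_on UNIV (F n)" and cvx_F: "convex_on UNIV (F n)" for n
    unfolding F_def by (rule lipschitz_on_envelope[OF ne] convex_on_envelope[OF ne])+
  have lip_g: "(norm a)-lipschitz_on UNIV g" "(norm a)-lipschitz_on UNIV (\<lambda>y. - g y)"
  proof -
    have "dist (a \<bullet> x) (a \<bullet> y) \<le> norm a * dist x y" for x y
      by (simp add: dist_norm inner_diff_right[symmetric] Cauchy_Schwarz_ineq2)
    then show "(norm a)-lipschitz_on UNIV g" "(norm a)-lipschitz_on UNIV (\<lambda>y. - g y)"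
      by (auto intro!: lipschitz_onI simp: g_def dist_minus[of "a \<bullet> x + f 0" "a \<bullet> y + f 0" for x y] simp del: minus_add_distrib)
  qed
  have cvx_g: "convex_on UNIV g" "convex_on UNIV (\<lambda>y. - g y)"
    by (auto intro!: convex_onI simp: g_def inner_add_right algebra_simps)
  have [measurable]: "g \<in> borel_measurable borel" "F n \<in> borel_measurable borel" for n
    using lipschitz_on_borel_measurable[OF lip_g(1)] lipschitz_on_borel_measurable[OF lip_F] .
  have int_g: "integrable \<mu> g" "integrable \<nu> g"
    using integrable_lipschitz[OF \<mu> lip_g(1)] integrable_lipschitz[OF \<nu> lip_g(1)] .
  have int_F: "integrable \<mu> (F n)" "integrable \<nu> (F n)" for n
    using integrable_lipschitz[OF \<mu> lip_F] integrable_lipschitz[OF \<nu> lip_F] .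
  \<comment> \<open>Both g and -g are convex and Lipschitz, so the assumed inequality holds in both
    directions.\<close>
  have eq_g: "(\<integral>x. g x \<partial>\<mu>) = (\<integral>x. g x \<partial>\<nu>)"
    using le[OF lip_g(1) cvx_g(1)] le[OF lip_g(2) cvx_g(2)] by simp
  have nn: "(\<integral>\<^sup>+ x. ennreal (f x - g x) \<partial>\<pi>) = (SUP n. \<integral>\<^sup>+ x. ennreal (F n x - g x) \<partial>\<pi>)"
    if [measurable_cong, simp]: "sets \<pi> = sets borel" for \<pi>
  proof -
    have "ennreal (f x - g x) = (SUP n. ennreal (F n x - g x))" for x
    proof (rule antisym)
      obtain c where c: "\<And>y. f x + c \<bullet> (y - x) \<le> f y"
        using convex_on_subgradient[OF cvx] by metis
      obtain n where n: "norm c \<le> real n"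
        using real_arch_simple by blast
      have "F n x = f x"
        unfolding F_def by (rule lipschitz_envelope_eq[OF c]) (use n in simp)
      then show "ennreal (f x - g x) \<le> (SUP n. ennreal (F n x - g x))"
        by (metis SUP_upper UNIV_I)
      show "(SUP n. ennreal (F n x - g x)) \<le> ennreal (f x - g x)"
        by (intro SUP_least ennreal_leI diff_right_mono) (simp only: F_def lipschitz_envelope_le[OF ne])
    qed
    moreover have "incseq (\<lambda>n x. ennreal (F n x - g x))"
      unfolding F_def
      by (intro incseq_SucI le_funI ennreal_leI diff_right_mono lipschitz_envelope_mono[OF ne]) simp
    ultimately show ?thesis
      by (simp add: nn_integral_monotone_convergence_SUP)
  qed
  have "(\<integral>\<^sup>+ x. ennreal (F n x - g x) \<partial>\<mu>) \<le> (\<integral>\<^sup>+ x. ennreal (F n x - g x) \<partial>\<nu>)" for n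
  proof -
    have "(\<integral>\<^sup>+ x. ennreal (F n x - g x) \<partial>\<mu>) = ennreal (\<integral>x. F n x - g x \<partial>\<mu>)"
      by (rule nn_integral_eq_integral) (use int_g int_F g_le_F in auto)
    also have "\<dots> \<le> ennreal (\<integral>x. F n x - g x \<partial>\<nu>)"
      using le[OF lip_F cvx_F] int_g int_F by (intro ennreal_leI) (simp add: eq_g)
    also have "\<dots> = (\<integral>\<^sup>+ x. ennreal (F n x - g x) \<partial>\<nu>)"
      by (rule nn_integral_eq_integral[symmetric]) (use int_g int_F g_le_F in auto)
    finally show ?thesis .
  qed
  then have "(\<integral>\<^sup>+ x. ennreal (f x - g x) \<partial>\<mu>) \<le> (\<integral>\<^sup>+ x. ennreal (f x - g x) \<partial>\<nu>)"
    unfolding nn[OF sets(1)] nn[OF sets(2)] by (rule SUP_mono')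
  then show "ext_integral \<mu> f \<le> ext_integral \<nu> f"
    using int_g g_le by (simp add: ext_integral_eq_minorant[where g = g] eq_g add_right_mono less_eq_ennreal.rep_eq)
qed

section \<open>One Euler step\<close>

lemma norm_mult_le_op_norm: "norm (A *v z) \<le> op_norm A * norm z"
  unfolding op_norm_def by (rule onorm) simp

lemma op_norm_nonneg: "0 \<le> op_norm A"
  unfolding op_norm_def by (rule onorm_pos_le) simp

lemma op_norm_scaleR: "op_norm (r *\<^sub>R A) = \<bar>r\<bar> * op_norm A"
  unfolding op_norm_def scaleR_matrix_vector_assoc[symmetric] by (rule onorm_scaleR) simp

lemma op_norm_triangle: "op_norm A \<le> op_norm (A - B) + op_norm B"
  unfolding op_norm_def
  using onorm_triangle[of "(*v) (A - B)" "(*v) B"] by (simp add: matrix_vector_mult_diff_rdistrib)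

text \<open>Passes from the operator norm of the assumptions to the norm of the matrix type, in
  which continuity, and with it joint measurability of a step, is expressed.\<close>

lemma continuous_on_op_norm_lipschitz:
  fixes s :: "'a::metric_space \<Rightarrow> real ^ 'q ^ 'd"
  assumes "\<And>x y. op_norm (s x - s y) \<le> K * dist x y"
  shows "continuous_on UNIV s"
proof (rule lipschitz_on_continuous_on)
  show "(real CARD('d) * (real CARD('q) * \<bar>K\<bar>))-lipschitz_on UNIV s"
  proof (rule lipschitz_onI)
    fix x y
    have "dist (s x) (s y) \<le> real CARD('d) * (real CARD('q) * op_norm (s x - s y))"
      unfolding dist_norm by (rule norm_matrix_le) (rule norm_mult_le_op_norm)
    also have "\<dots> \<le> real CARD('d) * (real CARD('q) * (\<bar>K\<bar> * dist x y))"
      by (intro mult_left_mono order_trans[OF assms] mult_right_mono) auto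
    finally show "dist (s x) (s y) \<le> real CARD('d) * (real CARD('q) * \<bar>K\<bar>) * dist x y"
      by (simp add: mult_ac)
  qed simp
qed

lemma continuous_on_matrix_vector_mult [continuous_intros]:
  fixes A :: "'a::topological_space \<Rightarrow> real ^ 'q ^ 'd"
  assumes "continuous_on S A" "continuous_on S v"
  shows "continuous_on S (\<lambda>x. A x *v v x)"
  unfolding matrix_vector_mult_def using assms by (intro continuous_intros)

lemma one_plus_powr_le:
  fixes t :: real
  assumes "0 \<le> t" "0 \<le> p"
  shows "(1 + t) powr p \<le> 2 powr p * (1 + t powr p)"
proof -
  have "(1 + t) powr p \<le> (2 * max 1 t) powr p"
    using assms by (intro powr_mono2) auto
  also have "\<dots> = 2 powr p * max 1 t powr p"
    by (simp add: powr_mult)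
  also have "max 1 t powr p \<le> 1 + t powr p"
    by (auto simp: max_def)
  finally show ?thesis by simp
qed

lemma (in pair_sigma_finite) integrable_mult_fst_snd:
  fixes g h :: "_ \<Rightarrow> real"
  assumes g: "integrable M1 g" and h: "integrable M2 h"
  shows "integrable (M1 \<Otimes>\<^sub>M M2) (\<lambda>(x, y). g x * h y)"
proof (rule Fubini_integrable)
  have [measurable]: "g \<in> borel_measurable M1" "h \<in> borel_measurable M2"
    using g h by auto
  show "(\<lambda>(x, y). g x * h y) \<in> borel_measurable (M1 \<Otimes>\<^sub>M M2)"
    by measurable
  show "integrable M1 (\<lambda>x. \<integral>y. norm (case (x, y) of (x, y) \<Rightarrow> g x * h y) \<partial>M2)"
    using g by (simp add: abs_mult)
  show "AE x in M1. integrable M2 (\<lambda>y. case (x, y) of (x, y) \<Rightarrow> g x * h y)"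
    using h by simp
qed

section \<open>A step with frozen law as a Markov kernel\<close>

text \<open>The law argument of the coefficients is fixed, so they depend on the state alone. Two
  instances with the same b describe the two chains.\<close>

locale euler_step =
  fixes b :: "real ^ 'd \<Rightarrow> real ^ 'd" and s :: "real ^ 'd \<Rightarrow> real ^ 'q ^ 'd"
    and A :: "real ^ 'd ^ 'd" and c :: "real ^ 'd" and K :: real
  assumes b_eq: "b x = A *v x + c"
    and s_lip: "op_norm (s x - s y) \<le> K * dist x y"
begin

definition next_state :: "real ^ 'd \<Rightarrow> real ^ 'q \<Rightarrow> real ^ 'd" where
  "next_state x z = b x + s x *v z"

text \<open>The product measure expresses that the fresh noise is independent of the current
  state.\<close>

definition next_law :: "(real ^ 'd) measure \<Rightarrow> (real ^ 'd) measure" where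
  "next_law \<mu> = distr (\<mu> \<Otimes>\<^sub>M gauss) borel (\<lambda>(x, z). next_state x z)"

lemma next_state_measurable [measurable]:
  "(\<lambda>(x, z). next_state x z) \<in> borel_measurable (borel \<Otimes>\<^sub>M borel)"
proof -
  have "continuous_on UNIV (\<lambda>p :: (real ^ 'd) \<times> (real ^ 'q). s (fst p))"
    by (rule continuous_on_compose2[OF continuous_on_op_norm_lipschitz[OF s_lip]]) (auto intro: continuous_intros)
  then have "continuous_on UNIV (\<lambda>(x, z). next_state x z)"
    unfolding next_state_def b_eq case_prod_beta by (intro continuous_intros)
  then show ?thesis
    unfolding borel_prod by (rule borel_measurable_continuous_onI)
qed

text \<open>The bound is a product so that its p-th power separates into a function of the state and
  one of the noise, each integrable on its own.\<close>

lemma next_state_growth: "\<exists>C\<ge>0. \<forall>x z. norm (next_state x z) \<le> C * ((1 + norm x) * (1 + norm z))"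
proof (intro exI conjI allI)
  let ?C = "op_norm A + norm c + (\<bar>K\<bar> + op_norm (s 0))"
  show "0 \<le> ?C"
    by (simp add: op_norm_nonneg)
  fix x :: "real ^ 'd" and z :: "real ^ 'q"
  have b: "norm (b x) \<le> (op_norm A + norm c) * (1 + norm x)"
  proof -
    have "norm (b x) \<le> op_norm A * norm x + norm c"
      unfolding b_eq using norm_triangle_ineq[of "A *v x" c] norm_mult_le_op_norm[of A x] by linarith
    also have "\<dots> \<le> (op_norm A + norm c) * (1 + norm x)"
      by (simp add: algebra_simps op_norm_nonneg)
    finally show ?thesis .
  qed
  have "op_norm (s x) \<le> K * dist x 0 + op_norm (s 0)"
    using op_norm_triangle[of "s x" "s 0"] s_lip[of x 0] by linarith
  also have "\<dots> \<le> \<bar>K\<bar> * norm x + op_norm (s 0)"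
    by (simp add: mult_right_mono)
  also have "\<dots> \<le> (\<bar>K\<bar> + op_norm (s 0)) * (1 + norm x)"
    by (simp add: algebra_simps op_norm_nonneg)
  finally have s: "op_norm (s x) \<le> (\<bar>K\<bar> + op_norm (s 0)) * (1 + norm x)" .
  have "norm (next_state x z) \<le> norm (b x) + op_norm (s x) * norm z"
    unfolding next_state_def using norm_triangle_ineq[of "b x" "s x *v z"] norm_mult_le_op_norm[of "s x" z] by linarith
  also have "\<dots> \<le> (op_norm A + norm c) * (1 + norm x) * (1 + norm z)
      + (\<bar>K\<bar> + op_norm (s 0)) * (1 + norm x) * (1 + norm z)"
  proof (rule add_mono)
    have "norm (b x) * 1 \<le> (op_norm A + norm c) * (1 + norm x) * (1 + norm z)"
      by (rule mult_mono[OF b]) (auto simp: op_norm_nonneg)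
    then show "norm (b x) \<le> (op_norm A + norm c) * (1 + norm x) * (1 + norm z)" by simp
    show "op_norm (s x) * norm z \<le> (\<bar>K\<bar> + op_norm (s 0)) * (1 + norm x) * (1 + norm z)"
      by (rule mult_mono[OF s]) (auto simp: op_norm_nonneg)
  qed
  finally show "norm (next_state x z) \<le> ?C * ((1 + norm x) * (1 + norm z))"
    by (simp add: algebra_simps)
qed

lemma integrable_next_state_powr:
  assumes \<mu>: "\<mu> \<in> prob_dists p" and p: "0 \<le> p"
  shows "integrable (\<mu> \<Otimes>\<^sub>M gauss) (\<lambda>(x, z). norm (next_state x z) powr p)"
proof -
  have [measurable_cong]: "sets \<mu> = sets borel"
    using \<mu> by (simp add: prob_dists_def)
  interpret \<mu>: prob_space \<mu> using \<mu> by (simp add: prob_dists_def)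
  interpret g: prob_space "gauss :: (real ^ 'q) measure" by (rule prob_space_gauss)
  interpret pair_prob_space \<mu> "gauss :: (real ^ 'q) measure" ..
  obtain C where C: "C \<ge> 0" "\<And>x z. norm (next_state x z) \<le> C * ((1 + norm x) * (1 + norm z))"
    using next_state_growth by blast
  let ?g = "\<lambda>x :: real ^ 'd. C powr p * (2 powr p * (1 + norm x powr p))"
  let ?h = "\<lambda>z :: real ^ 'q. 2 powr p * (1 + norm z powr p)"
  have "integrable \<mu> (\<lambda>x. norm x powr p)"
    using \<mu> by (simp add: prob_dists_def)
  moreover note integrable_norm_powr_gauss[OF p]
  ultimately have "integrable (\<mu> \<Otimes>\<^sub>M gauss) (\<lambda>(x, z). ?g x * ?h z)"
    by (intro integrable_mult_fst_snd) auto
  then show ?thesis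
  proof (rule Bochner_Integration.integrable_bound)
    have "norm (next_state x z) powr p \<le> ?g x * ?h z" for x z
    proof -
      have "norm (next_state x z) powr p \<le> (C * ((1 + norm x) * (1 + norm z))) powr p"
        by (intro powr_mono2 C p) auto
      also have "\<dots> = C powr p * (1 + norm x) powr p * (1 + norm z) powr p"
        using C(1) by (simp add: powr_mult)
      also have "\<dots> \<le> ?g x * ?h z"
        using p by (intro mult_mono one_plus_powr_le) auto
      finally show ?thesis .
    qed
    then show "AE u in \<mu> \<Otimes>\<^sub>M gauss. norm (case u of (x, z) \<Rightarrow> norm (next_state x z) powr p)
        \<le> norm (case u of (x, z) \<Rightarrow> ?g x * ?h z)"
      by (intro AE_I2) (auto split: prod.split intro: order_trans[OF _ abs_ge_self])
  qed measurable
qed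

lemma next_law_prob_dists:
  assumes \<mu>: "\<mu> \<in> prob_dists p" and p: "0 \<le> p"
  shows "next_law \<mu> \<in> prob_dists p"
proof -
  have [measurable_cong]: "sets \<mu> = sets borel"
    using \<mu> by (simp add: prob_dists_def)
  interpret \<mu>: prob_space \<mu> using \<mu> by (simp add: prob_dists_def)
  interpret g: prob_space "gauss :: (real ^ 'q) measure" by (rule prob_space_gauss)
  interpret pair_prob_space \<mu> "gauss :: (real ^ 'q) measure" ..
  show ?thesis
    unfolding prob_dists_def next_law_def
    using integrable_next_state_powr[OF assms]
    by (auto intro!: prob_space_distr simp: integrable_distr_eq split_beta')
qed

text \<open>The operator Q of the overview, dual to \<open>next_law\<close>.\<close>

definition step_operator :: "(real ^ 'd \<Rightarrow> real) \<Rightarrow> real ^ 'd \<Rightarrow> real" where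
  "step_operator f x = (\<integral>z. f (b x + s x *v z) \<partial>gauss)"

lemma integral_next_law:
  assumes \<mu>: "\<mu> \<in> prob_dists 1" and lip: "C-lipschitz_on UNIV f"
  shows "integrable \<mu> (step_operator f)" "(\<integral>x. f x \<partial>next_law \<mu>) = (\<integral>x. step_operator f x \<partial>\<mu>)"
proof -
  have [measurable_cong]: "sets \<mu> = sets borel"
    using \<mu> by (simp add: prob_dists_def)
  interpret \<mu>: prob_space \<mu> using \<mu> by (simp add: prob_dists_def)
  interpret g: prob_space "gauss :: (real ^ 'q) measure" by (rule prob_space_gauss)
  interpret pair_prob_space \<mu> "gauss :: (real ^ 'q) measure" ..
  have [measurable]: "f \<in> borel_measurable borel"
    using lip by (rule lipschitz_on_borel_measurable)
  have meas: "(\<lambda>(x, z). next_state x z) \<in> borel_measurable (\<mu> \<Otimes>\<^sub>M gauss)"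
    by measurable
  \<comment> \<open>Integrability on the product is read off from the image law: its first moment is
    finite and f grows at most linearly.\<close>
  have "integrable (next_law \<mu>) f"
    by (rule integrable_lipschitz[OF next_law_prob_dists[OF \<mu>] lip]) simp
  then have int: "integrable (\<mu> \<Otimes>\<^sub>M gauss) (\<lambda>(x, z). f (next_state x z))"
    unfolding next_law_def by (subst (asm) integrable_distr_eq[OF meas]) (auto simp: split_beta')
  show "integrable \<mu> (step_operator f)"
    using integrable_fst'[OF int] by (simp add: step_operator_def[abs_def] next_state_def)
  have "(\<integral>x. f x \<partial>next_law \<mu>) = (\<integral>u. (case u of (x, z) \<Rightarrow> f (next_state x z)) \<partial>(\<mu> \<Otimes>\<^sub>M gauss))"
    unfolding next_law_def by (subst integral_distr[OF meas]) (auto simp: split_beta')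
  also have "\<dots> = (\<integral>x. step_operator f x \<partial>\<mu>)"
    using integral_fst'[OF int] by (simp add: step_operator_def[abs_def] next_state_def)
  finally show "(\<integral>x. f x \<partial>next_law \<mu>) = (\<integral>x. step_operator f x \<partial>\<mu>)" .
qed

lemma convex_on_step_operator:
  assumes s_convex: "\<And>x y l. 0 \<le> l \<Longrightarrow> l \<le> 1 \<Longrightarrow>
      s (l *\<^sub>R x + (1 - l) *\<^sub>R y) \<preceq>\<^sub>M l *\<^sub>R s x + (1 - l) *\<^sub>R s y"
    and lip: "C-lipschitz_on UNIV f" and cvx: "convex_on UNIV f"
  shows "convex_on UNIV (step_operator f)"
proof (rule convex_onI)
  fix t :: real and x y :: "real ^ 'd" assume t: "0 < t" "t < 1"
  let ?w = "(1 - t) *\<^sub>R x + t *\<^sub>R y"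
  have b: "b ?w = (1 - t) *\<^sub>R b x + t *\<^sub>R b y"
    unfolding b_eq by (simp add: matrix_vector_right_distrib matrix_vector_mult_scaleR algebra_simps)
  have "step_operator f ?w \<le> (\<integral>z. f (b ?w + ((1 - t) *\<^sub>R s x + t *\<^sub>R s y) *v z) \<partial>gauss)"
    unfolding step_operator_def
    using s_convex[of "1 - t" x y] t by (intro gauss_mono_mat_le[OF lip cvx]) simp
  \<comment> \<open>Once the matrix is a convex combination, the same z drives both endpoints, and
    affinity of b turns the argument of f into a convex combination of their next states.\<close>
  also have "\<dots> \<le> (\<integral>z. (1 - t) * f (b x + s x *v z) + t * f (b y + s y *v z) \<partial>gauss)"
  proof (intro integral_mono Bochner_Integration.integrable_add integrable_mult_right integrable_gauss_lipschitz[OF lip])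
    fix z
    have "b ?w + ((1 - t) *\<^sub>R s x + t *\<^sub>R s y) *v z = (1 - t) *\<^sub>R (b x + s x *v z) + t *\<^sub>R (b y + s y *v z)"
      unfolding b by (simp add: matrix_vector_mult_add_rdistrib scaleR_matrix_vector_assoc[symmetric] algebra_simps)
    then show "f (b ?w + ((1 - t) *\<^sub>R s x + t *\<^sub>R s y) *v z) \<le> (1 - t) * f (b x + s x *v z) + t * f (b y + s y *v z)"
      using convex_onD[OF cvx, of t "b x + s x *v z" "b y + s y *v z"] t by simp
  qed
  also have "\<dots> = (1 - t) * step_operator f x + t * step_operator f y"
    unfolding step_operator_def by (simp add: integrable_gauss_lipschitz[OF lip])
  finally show "step_operator f ?w \<le> (1 - t) * step_operator f x + t * step_operator f y" .
qed simp

end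

lemma next_law_cv_mono:
  fixes \<mu> \<nu> :: "(real ^ 'd) measure" and s t :: "real ^ 'd \<Rightarrow> real ^ 'q ^ 'd"
  assumes le: "\<mu> \<preceq>\<^sub>c\<^sub>v \<nu>"
    and s: "euler_step b s A c K" and t: "euler_step b t A' c' K'"
    and s_convex: "\<And>x y l. 0 \<le> l \<Longrightarrow> l \<le> 1 \<Longrightarrow>
      s (l *\<^sub>R x + (1 - l) *\<^sub>R y) \<preceq>\<^sub>M l *\<^sub>R s x + (1 - l) *\<^sub>R s y"
    and s_le_t: "\<And>x. s x \<preceq>\<^sub>M t x"
  shows "euler_step.next_law b s \<mu> \<preceq>\<^sub>c\<^sub>v euler_step.next_law b t \<nu>"
proof -
  interpret s: euler_step b s A c K by fact
  interpret t: euler_step b t A' c' K' by fact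
  have \<mu>: "\<mu> \<in> prob_dists 1" and \<nu>: "\<nu> \<in> prob_dists 1"
    using le by (auto simp: cv_le_def)
  show ?thesis
  proof (rule cv_leI_lipschitz)
    show "s.next_law \<mu> \<in> prob_dists 1" "t.next_law \<nu> \<in> prob_dists 1"
      using s.next_law_prob_dists[OF \<mu>] t.next_law_prob_dists[OF \<nu>] by simp_all
    fix C and f :: "real ^ 'd \<Rightarrow> real"
    assume lip: "C-lipschitz_on UNIV f" and cvx: "convex_on UNIV f"
    have "(\<integral>x. f x \<partial>s.next_law \<mu>) = (\<integral>x. s.step_operator f x \<partial>\<mu>)"
      by (rule s.integral_next_law(2)[OF \<mu> lip])
    also have "\<dots> \<le> (\<integral>x. s.step_operator f x \<partial>\<nu>)"
      by (intro cv_leD_integral[OF le] s.convex_on_step_operator[OF s_convex lip cvx]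
          s.integral_next_law(1)[OF \<mu> lip] s.integral_next_law(1)[OF \<nu> lip])
    also have "\<dots> \<le> (\<integral>x. t.step_operator f x \<partial>\<nu>)"
      unfolding s.step_operator_def t.step_operator_def
      using s.integral_next_law(1)[OF \<nu> lip] t.integral_next_law(1)[OF \<nu> lip]
      by (intro integral_mono gauss_mono_mat_le[OF lip cvx s_le_t])
        (simp_all add: s.step_operator_def[abs_def] t.step_operator_def[abs_def])
    also have "\<dots> = (\<integral>x. f x \<partial>t.next_law \<nu>)"
      by (rule t.integral_next_law(2)[OF \<nu> lip, symmetric])
    finally show "(\<integral>x. f x \<partial>s.next_law \<mu>) \<le> (\<integral>x. f x \<partial>t.next_law \<nu>)" .
  qed
qed

section \<open>Independence of the noise\<close>

text \<open>Independence is assumed for the pair of initial values; f selects the component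
  belonging to one chain.\<close>

lemma indep_rv_joint_law:
  assumes P: "prob_space P" and ind: "indep_rv P S W S' V" and f [measurable]: "f \<in> measurable S N"
  shows "distr P (N \<Otimes>\<^sub>M S') (\<lambda>\<omega>. (f (W \<omega>), V \<omega>)) = distr P N (\<lambda>\<omega>. f (W \<omega>)) \<Otimes>\<^sub>M distr P S' V"
proof (rule pair_measure_eqI[symmetric])
  interpret prob_space P by fact
  have W [measurable]: "W \<in> measurable P S" and V [measurable]: "V \<in> measurable P S'"
    and ind': "indep_set (sets (vimage_algebra (space P) W S)) (sets (vimage_algebra (space P) V S'))"
    using ind by (auto simp: indep_rv_def)
  show "sigma_finite_measure (distr P N (\<lambda>\<omega>. f (W \<omega>)))" "sigma_finite_measure (distr P S' V)"
    by (intro prob_space_imp_sigma_finite prob_space_distr; measurable)+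
  show "sets (distr P N (\<lambda>\<omega>. f (W \<omega>)) \<Otimes>\<^sub>M distr P S' V) = sets (distr P (N \<Otimes>\<^sub>M S') (\<lambda>\<omega>. (f (W \<omega>), V \<omega>)))"
    by simp
  fix A B assume "A \<in> sets (distr P N (\<lambda>\<omega>. f (W \<omega>)))" "B \<in> sets (distr P S' V)"
  then have A [measurable]: "A \<in> sets N" and B [measurable]: "B \<in> sets S'" by auto
  let ?E = "(\<lambda>\<omega>. f (W \<omega>)) -` A \<inter> space P" and ?F = "V -` B \<inter> space P"
  have "?E = W -` (f -` A \<inter> space S) \<inter> space P"
    using measurable_space[OF W] by auto
  then have "?E \<in> sets (vimage_algebra (space P) W S)"
    using in_vimage_algebra[OF measurable_sets[OF f A]] by simp
  moreover have "?F \<in> sets (vimage_algebra (space P) V S')"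
    using B by (rule in_vimage_algebra)
  ultimately have "prob (?E \<inter> ?F) = prob ?E * prob ?F"
    by (rule indep_setD[OF ind'])
  then have "emeasure P ?E * emeasure P ?F = emeasure P (?E \<inter> ?F)"
    by (simp add: emeasure_eq_measure ennreal_mult)
  also have "?E \<inter> ?F = (\<lambda>\<omega>. (f (W \<omega>), V \<omega>)) -` (A \<times> B) \<inter> space P"
    by auto
  finally show "emeasure (distr P N (\<lambda>\<omega>. f (W \<omega>))) A * emeasure (distr P S' V) B
      = emeasure (distr P (N \<Otimes>\<^sub>M S') (\<lambda>\<omega>. (f (W \<omega>), V \<omega>))) (A \<times> B)"
    by (simp add: emeasure_distr)
qed

lemma joint_law_next:
  fixes Z :: "'i \<Rightarrow> 'a \<Rightarrow> 's"
  assumes P: "prob_space P" and G: "prob_space G" and [measurable_cong]: "sets G = sets S"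
    and i: "i \<notin> J" and fin: "finite J"
    and X [measurable]: "X \<in> measurable P N"
    and Z [measurable]: "\<And>k. k \<in> insert i J \<Longrightarrow> Z k \<in> measurable P S"
    and f [measurable]: "(\<lambda>(x, z). f x z) \<in> measurable (N \<Otimes>\<^sub>M S) N'"
    and law: "distr P (N \<Otimes>\<^sub>M PiM (insert i J) (\<lambda>_. S)) (\<lambda>\<omega>. (X \<omega>, \<lambda>k\<in>insert i J. Z k \<omega>))
      = distr P N X \<Otimes>\<^sub>M PiM (insert i J) (\<lambda>_. G)"
  shows "distr P N' (\<lambda>\<omega>. f (X \<omega>) (Z i \<omega>)) = distr (distr P N X \<Otimes>\<^sub>M G) N' (\<lambda>(x, z). f x z)"
    and "distr P (N' \<Otimes>\<^sub>M PiM J (\<lambda>_. S)) (\<lambda>\<omega>. (f (X \<omega>) (Z i \<omega>), \<lambda>k\<in>J. Z k \<omega>))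
      = distr P N' (\<lambda>\<omega>. f (X \<omega>) (Z i \<omega>)) \<Otimes>\<^sub>M PiM J (\<lambda>_. G)"
proof -
  let ?\<mu> = "distr P N X" and ?\<nu> = "distr (distr P N X \<Otimes>\<^sub>M G) N' (\<lambda>(x, z). f x z)"
  let ?SI = "PiM (insert i J) (\<lambda>_. S)" and ?SJ = "PiM J (\<lambda>_. S)"
  let ?GI = "PiM (insert i J) (\<lambda>_. G)" and ?GJ = "PiM J (\<lambda>_. G)"
  interpret PS: prob_space P by fact
  interpret G: prob_space G by fact
  interpret \<mu>: prob_space ?\<mu> by (rule PS.prob_space_distr) measurable
  interpret GI: prob_space ?GI by (intro prob_space_PiM G)
  interpret GJ: prob_space ?GJ by (intro prob_space_PiM G)
  have congI [measurable_cong, simp]: "sets ?GI = sets ?SI" and congJ [measurable_cong, simp]: "sets ?GJ = sets ?SJ"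
    by (auto intro!: sets_PiM_cong simp: \<open>sets G = sets S\<close>)
  have spG: "space G = space S"
    using \<open>sets G = sets S\<close> by (rule sets_eq_imp_space_eq)
  have [measurable]: "(\<lambda>\<omega>. \<lambda>k\<in>insert i J. Z k \<omega>) \<in> measurable P ?SI" "(\<lambda>\<omega>. \<lambda>k\<in>J. Z k \<omega>) \<in> measurable P ?SJ"
    by (auto intro!: measurable_restrict Z)
  have Zi [measurable]: "Z i \<in> measurable P S" by (simp add: Z)
  have fx [measurable]: "f x \<in> measurable S N'" if "x \<in> space N" for x
    using measurable_Pair2[OF f that] by simp
  interpret \<nu>: prob_space ?\<nu>
  proof -
    interpret MG: pair_prob_space ?\<mu> G ..
    show "prob_space ?\<nu>" by (rule MG.prob_space_distr) measurable
  qed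
  have sets_\<mu>GI: "sets (?\<mu> \<Otimes>\<^sub>M ?GI) = sets (N \<Otimes>\<^sub>M ?SI)" and sets_\<mu>G: "sets (?\<mu> \<Otimes>\<^sub>M G) = sets (N \<Otimes>\<^sub>M S)"
    by (intro sets_pair_measure_cong congI sets_distr \<open>sets G = sets S\<close>)+
  have joint: "distr P (N' \<Otimes>\<^sub>M ?SJ) (\<lambda>\<omega>. (f (X \<omega>) (Z i \<omega>), \<lambda>k\<in>J. Z k \<omega>)) = ?\<nu> \<Otimes>\<^sub>M ?GJ"
  proof (rule pair_measure_eqI[symmetric])
    show "sigma_finite_measure ?\<nu>" "sigma_finite_measure ?GJ" ..
    show "sets (?\<nu> \<Otimes>\<^sub>M ?GJ) = sets (distr P (N' \<Otimes>\<^sub>M ?SJ) (\<lambda>\<omega>. (f (X \<omega>) (Z i \<omega>), \<lambda>k\<in>J. Z k \<omega>)))"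
      unfolding sets_distr by (intro sets_pair_measure_cong congJ sets_distr)
    fix A B assume "A \<in> sets ?\<nu>" "B \<in> sets ?GJ"
    then have A [measurable]: "A \<in> sets N'" and B [measurable]: "B \<in> sets ?SJ" by auto
    let ?g = "\<lambda>(x, \<zeta>). (f x (\<zeta> i), restrict \<zeta> J)"
    have [measurable]: "(\<lambda>\<zeta>. \<zeta> i) \<in> measurable ?SI S" "(\<lambda>\<zeta>. restrict \<zeta> J) \<in> measurable ?SI ?SJ"
      by (auto intro!: measurable_component_singleton measurable_restrict_subset)
    have g [measurable]: "?g \<in> measurable (N \<Otimes>\<^sub>M ?SI) (N' \<Otimes>\<^sub>M ?SJ)"
      by measurable
    let ?E = "?g -` (A \<times> B) \<inter> space (N \<Otimes>\<^sub>M ?SI)"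
    have E [measurable]: "?E \<in> sets (N \<Otimes>\<^sub>M ?SI)"
      using g by (rule measurable_sets) measurable
    have "emeasure (distr P (N' \<Otimes>\<^sub>M ?SJ) (\<lambda>\<omega>. (f (X \<omega>) (Z i \<omega>), \<lambda>k\<in>J. Z k \<omega>))) (A \<times> B)
        = emeasure P ((\<lambda>\<omega>. (f (X \<omega>) (Z i \<omega>), \<lambda>k\<in>J. Z k \<omega>)) -` (A \<times> B) \<inter> space P)"
      by (rule emeasure_distr) measurable
    also have "(\<lambda>\<omega>. (f (X \<omega>) (Z i \<omega>), \<lambda>k\<in>J. Z k \<omega>)) -` (A \<times> B) \<inter> space P
        = (\<lambda>\<omega>. (X \<omega>, \<lambda>k\<in>insert i J. Z k \<omega>)) -` ?E \<inter> space P"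
    proof -
      have meas: "(\<lambda>\<omega>. (X \<omega>, \<lambda>k\<in>insert i J. Z k \<omega>)) \<in> measurable P (N \<Otimes>\<^sub>M ?SI)"
        by measurable
      have "(X \<omega>, \<lambda>k\<in>insert i J. Z k \<omega>) \<in> space (N \<Otimes>\<^sub>M ?SI)" if "\<omega> \<in> space P" for \<omega>
        by (rule measurable_space[OF meas that])
      moreover have "restrict (\<lambda>k\<in>insert i J. Z k \<omega>) J = (\<lambda>k\<in>J. Z k \<omega>)" for \<omega>
        by (auto simp: fun_eq_iff)
      ultimately show ?thesis by auto
    qed
    also have "emeasure P \<dots> = emeasure (distr P (N \<Otimes>\<^sub>M ?SI) (\<lambda>\<omega>. (X \<omega>, \<lambda>k\<in>insert i J. Z k \<omega>))) ?E"
      by (rule emeasure_distr[symmetric]) measurable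
    also have "\<dots> = emeasure (?\<mu> \<Otimes>\<^sub>M ?GI) ?E"
      by (simp only: law)
    also have "\<dots> = (\<integral>\<^sup>+ x. emeasure ?GI (Pair x -` ?E) \<partial>?\<mu>)"
      by (rule GI.emeasure_pair_measure_alt) (simp only: sets_\<mu>GI E)
    also have "\<dots> = (\<integral>\<^sup>+ x. emeasure G (f x -` A \<inter> space G) * emeasure ?GJ B \<partial>?\<mu>)"
    proof (rule nn_integral_cong)
      fix x assume "x \<in> space ?\<mu>"
      then have x: "x \<in> space N" by simp
      \<comment> \<open>\<open>?up\<close> inserts the coordinate i. The product over
        \<open>insert i J\<close> is the image of a product measure under it, which separates the
        consumed noise from the remaining one.\<close>
      let ?up = "\<lambda>(z, \<zeta>). \<zeta>(i := z)"
      have up: "?up \<in> measurable (G \<Otimes>\<^sub>M ?GJ) ?GI"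
        unfolding case_prod_beta' by (rule measurable_fun_upd[where J = J]) auto
      have "emeasure ?GI (Pair x -` ?E) = emeasure (distr (G \<Otimes>\<^sub>M ?GJ) ?GI ?up) (Pair x -` ?E)"
        by (simp only: distr_pair_PiM_eq_PiM[OF G G])
      also have "\<dots> = emeasure (G \<Otimes>\<^sub>M ?GJ) (?up -` (Pair x -` ?E) \<inter> space (G \<Otimes>\<^sub>M ?GJ))"
        using sets_Pair1[OF E] by (intro emeasure_distr[OF up]) simp
      \<comment> \<open>For fixed x the section is a rectangle: as i is not in J, restricting to J
        undoes the update.\<close>
      also have "?up -` (Pair x -` ?E) \<inter> space (G \<Otimes>\<^sub>M ?GJ) = (f x -` A \<inter> space G) \<times> B"
      proof -
        have "restrict (\<zeta>(i := z)) J = \<zeta>" if "\<zeta> \<in> space ?GJ" for \<zeta> :: "'i \<Rightarrow> 's" and z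
          using that i by (auto simp: space_PiM PiE_iff extensional_def fun_eq_iff)
        moreover have "B \<subseteq> space ?GJ"
          using sets.sets_into_space[OF B] by (simp add: space_PiM spG)
        moreover have "\<zeta>(i := z) \<in> space ?SI" if "\<zeta> \<in> space ?GJ" "z \<in> space G" for \<zeta> z
          using that by (auto simp: space_PiM PiE_iff extensional_def spG)
        ultimately show ?thesis
          using x by (auto simp: space_pair_measure)
      qed
      also have "emeasure (G \<Otimes>\<^sub>M ?GJ) \<dots> = emeasure G (f x -` A \<inter> space G) * emeasure ?GJ B"
        using measurable_sets[OF fx[OF x] A] by (intro GJ.emeasure_pair_measure_Times) (simp_all add: spG \<open>sets G = sets S\<close>)
      finally show "emeasure ?GI (Pair x -` ?E) = emeasure G (f x -` A \<inter> space G) * emeasure ?GJ B" .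
    qed
    \<comment> \<open>The preimages are rewritten as sections of one measurable set of the product,
      which yields their measurability in x and the section formula for its measure.\<close>
    also have "\<dots> = (\<integral>\<^sup>+ x. emeasure G (Pair x -` ((\<lambda>(x, z). f x z) -` A \<inter> space (N \<Otimes>\<^sub>M S))) * emeasure ?GJ B \<partial>?\<mu>)"
      by (intro nn_integral_cong arg_cong2[where f = "(*)"] arg_cong[where f = "emeasure G"])
        (auto simp: space_pair_measure spG)
    also have "\<dots> = (\<integral>\<^sup>+ x. emeasure G (Pair x -` ((\<lambda>(x, z). f x z) -` A \<inter> space (N \<Otimes>\<^sub>M S))) \<partial>?\<mu>) * emeasure ?GJ B"
      using measurable_sets[OF f A] by (intro nn_integral_multc G.measurable_emeasure_Pair) (simp only: sets_\<mu>G)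
    also have "(\<integral>\<^sup>+ x. emeasure G (Pair x -` ((\<lambda>(x, z). f x z) -` A \<inter> space (N \<Otimes>\<^sub>M S))) \<partial>?\<mu>)
        = emeasure (?\<mu> \<Otimes>\<^sub>M G) ((\<lambda>(x, z). f x z) -` A \<inter> space (N \<Otimes>\<^sub>M S))"
      using measurable_sets[OF f A] by (intro G.emeasure_pair_measure_alt[symmetric]) (simp only: sets_\<mu>G)
    also have "\<dots> = emeasure ?\<nu> A"
      by (subst emeasure_distr) (auto simp: space_pair_measure spG)
    finally show "emeasure ?\<nu> A * emeasure ?GJ B
        = emeasure (distr P (N' \<Otimes>\<^sub>M ?SJ) (\<lambda>\<omega>. (f (X \<omega>) (Z i \<omega>), \<lambda>k\<in>J. Z k \<omega>))) (A \<times> B)" ..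
  qed
  have "distr P N' (\<lambda>\<omega>. f (X \<omega>) (Z i \<omega>))
      = distr (distr P (N' \<Otimes>\<^sub>M ?SJ) (\<lambda>\<omega>. (f (X \<omega>) (Z i \<omega>), \<lambda>k\<in>J. Z k \<omega>))) N' fst"
    by (subst distr_distr) (auto simp: comp_def)
  also have "\<dots> = distr (?\<nu> \<Otimes>\<^sub>M ?GJ) ?\<nu> fst"
    unfolding joint by (rule distr_cong) auto
  also have "\<dots> = ?\<nu>"
    by (rule GJ.distr_pair_fst)
  finally show eq: "distr P N' (\<lambda>\<omega>. f (X \<omega>) (Z i \<omega>)) = ?\<nu>" .
  show "distr P (N' \<Otimes>\<^sub>M ?SJ) (\<lambda>\<omega>. (f (X \<omega>) (Z i \<omega>), \<lambda>k\<in>J. Z k \<omega>))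
      = distr P N' (\<lambda>\<omega>. f (X \<omega>) (Z i \<omega>)) \<Otimes>\<^sub>M ?GJ"
    unfolding eq by (rule joint)
qed

section \<open>The Euler scheme\<close>

text \<open>Witnessed by the diagonal coupling. At equal laws the Lipschitz assumption thus becomes
  a Lipschitz bound in the state.\<close>

lemma wasserstein_self:
  fixes \<mu> :: "(real ^ 'd) measure"
  assumes \<mu>: "\<mu> \<in> prob_dists p"
  shows "wasserstein p \<mu> \<mu> = 0"
proof -
  interpret prob_space \<mu> using \<mu> by (simp add: prob_dists_def)
  have sets [measurable_cong]: "sets \<mu> = sets borel"
    using \<mu> by (simp add: prob_dists_def)
  let ?\<pi> = "distr \<mu> (borel \<Otimes>\<^sub>M borel) (\<lambda>x. (x, x))"
  have "distr ?\<pi> borel fst = \<mu>" "distr ?\<pi> borel snd = \<mu>"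
    by (simp_all add: distr_distr comp_def distr_id2 sets)
  moreover have "prob_space ?\<pi>"
    by (rule prob_space_distr) measurable
  ultimately have "?\<pi> \<in> couplings \<mu> \<mu>"
    by (simp add: couplings_def)
  then have "(INF \<pi>\<in>couplings \<mu> \<mu>. \<integral>\<^sup>+ z. ennreal (norm (fst z - snd z) powr p) \<partial>\<pi>)
      \<le> (\<integral>\<^sup>+ z. ennreal (norm (fst z - snd z) powr p) \<partial>?\<pi>)"
    by (rule INF_lower)
  also have "\<dots> = 0"
    by (subst nn_integral_distr) auto
  finally show ?thesis
    by (simp add: wasserstein_def)
qed

lemma euler_step_holder_lipschitz:
  assumes hl: "holder_lipschitz op_norm p T \<rho> L L' \<sigma>" and m: "m \<le> M" and T: "T > 0" and M: "M \<ge> 1"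
    and \<mu>: "\<mu> \<in> prob_dists p"
    and aff: "\<And>x. b x = A *v x + c"
  shows "euler_step b (\<lambda>x. diffusion_step T M \<sigma> m x \<mu>) A c (sqrt (T / real M) * L)"
proof
  show "b x = A *v x + c" for x by (rule aff)
  fix x y
  let ?t = "real m * (T / real M)"
  have "0 \<le> ?t" "?t \<le> T"
    using m T M by (auto simp: field_simps)
  then have "op_norm (\<sigma> ?t x \<mu> - \<sigma> ?t y \<mu>) \<le> L * (norm (x - y) + wasserstein p \<mu> \<mu>)"
    using hl \<mu> unfolding holder_lipschitz_def by blast
  then have le: "op_norm (\<sigma> ?t x \<mu> - \<sigma> ?t y \<mu>) \<le> L * dist x y"
    by (simp add: wasserstein_self[OF \<mu>] dist_norm)
  have "op_norm (diffusion_step T M \<sigma> m x \<mu> - diffusion_step T M \<sigma> m y \<mu>)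
      = sqrt (T / real M) * op_norm (\<sigma> ?t x \<mu> - \<sigma> ?t y \<mu>)"
    using T by (simp add: diffusion_step_def Let_def scaleR_diff_right[symmetric] op_norm_scaleR)
  also have "\<dots> \<le> sqrt (T / real M) * L * dist x y"
    using mult_left_mono[OF le, of "sqrt (T / real M)"] T by (simp add: mult.assoc)
  finally show "op_norm (diffusion_step T M \<sigma> m x \<mu> - diffusion_step T M \<sigma> m y \<mu>) \<le> sqrt (T / real M) * L * dist x y" .
qed

text \<open>The laws alone do not form an inductive statement: the next law depends on how the state
  is coupled with the next noise. The joint law with all noise still to come is therefore carried
  along, together with the moment bound that makes \<open>step\<close> applicable.\<close>

lemma euler_scheme_law:
  fixes P :: "'a measure" and U :: "'a \<Rightarrow> real ^ 'd" and Z :: "nat \<Rightarrow> 'a \<Rightarrow> real ^ 'q"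
    and bs :: "nat \<Rightarrow> real ^ 'd \<Rightarrow> (real ^ 'd) measure \<Rightarrow> real ^ 'd"
    and ss :: "nat \<Rightarrow> real ^ 'd \<Rightarrow> (real ^ 'd) measure \<Rightarrow> real ^ 'q ^ 'd"
  defines "X \<equiv> \<lambda>m. euler_scheme P bs ss Z U m"
  assumes P: "prob_space P" and U [measurable]: "U \<in> borel_measurable P" and p: "0 \<le> p"
    and law0: "distr P borel U \<in> prob_dists p"
    and Z: "\<And>k. k \<in> {1..M} \<Longrightarrow> Z k \<in> borel_measurable P"
    and joint0: "distr P (borel \<Otimes>\<^sub>M PiM {1..M} (\<lambda>_. borel)) (\<lambda>\<omega>. (U \<omega>, \<lambda>k\<in>{1..M}. Z k \<omega>))
      = distr P borel U \<Otimes>\<^sub>M PiM {1..M} (\<lambda>_. gauss)"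
    and step: "\<And>m \<mu>. m < M \<Longrightarrow> \<mu> \<in> prob_dists p \<Longrightarrow>
      \<exists>A c K. euler_step (\<lambda>x. bs m x \<mu>) (\<lambda>x. ss m x \<mu>) A c K"
    and m: "m \<le> M"
  shows "X m \<in> borel_measurable P" "distr P borel (X m) \<in> prob_dists p"
    and "m < M \<Longrightarrow> distr P borel (X (Suc m))
      = euler_step.next_law (\<lambda>x. bs m x (distr P borel (X m))) (\<lambda>x. ss m x (distr P borel (X m))) (distr P borel (X m))"
proof -
  let ?law = "\<lambda>m. distr P borel (X m)"
  define J where "J m \<longleftrightarrow> distr P (borel \<Otimes>\<^sub>M PiM {Suc m..M} (\<lambda>_. borel)) (\<lambda>\<omega>. (X m \<omega>, \<lambda>k\<in>{Suc m..M}. Z k \<omega>))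
      = ?law m \<Otimes>\<^sub>M PiM {Suc m..M} (\<lambda>_. gauss)" for m
  have next_step: "X (Suc m) \<in> borel_measurable P \<and> ?law (Suc m) \<in> prob_dists p \<and> J (Suc m) \<and>
      ?law (Suc m) = euler_step.next_law (\<lambda>x. bs m x (?law m)) (\<lambda>x. ss m x (?law m)) (?law m)"
    if m: "m < M" and IH: "X m \<in> borel_measurable P" "?law m \<in> prob_dists p" "J m" for m
  proof -
    note [measurable] = IH(1)
    obtain A c K where "euler_step (\<lambda>x. bs m x (?law m)) (\<lambda>x. ss m x (?law m)) A c K"
      using step[OF m IH(2)] by blast
    then interpret euler_step "\<lambda>x. bs m x (?law m)" "\<lambda>x. ss m x (?law m)" A c K .
    have Xs: "X (Suc m) = (\<lambda>\<omega>. next_state (X m \<omega>) (Z (Suc m) \<omega>))"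
      unfolding next_state_def by (simp add: X_def Let_def)
    have I: "{Suc m..M} = insert (Suc m) {Suc (Suc m)..M}"
      using m by auto
    have Zm: "Z k \<in> borel_measurable P" if "k \<in> insert (Suc m) {Suc (Suc m)..M}" for k
      using that m by (intro Z) auto
    then have [measurable]: "Z (Suc m) \<in> borel_measurable P" by blast
    have Xm: "X (Suc m) \<in> borel_measurable P"
      unfolding Xs by measurable
    note joint_law_next[OF P prob_space_gauss sets_gauss _ _ IH(1) Zm next_state_measurable
        IH(3)[unfolded J_def I]]
    then have 1: "?law (Suc m) = next_law (?law m)" and 2: "J (Suc m)"
      unfolding J_def Xs next_law_def by auto
    show ?thesis
      using Xm 1 2 next_law_prob_dists[OF IH(2) p] by simp
  qed
  have inv: "X m \<in> borel_measurable P \<and> ?law m \<in> prob_dists p \<and> J m" if "m \<le> M" for m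
    using that
  proof (induction m)
    case 0
    then show ?case
      using U law0 joint0 by (simp add: X_def J_def)
  next
    case (Suc m)
    then show ?case
      using next_step[of m] by (auto simp: Suc_le_eq)
  qed
  show "X m \<in> borel_measurable P" "distr P borel (X m) \<in> prob_dists p"
    using inv[OF m] by auto
  show "?law (Suc m) = euler_step.next_law (\<lambda>x. bs m x (?law m)) (\<lambda>x. ss m x (?law m)) (?law m)" if "m < M"
    using next_step[OF that] inv[OF m] by simp
qed

lemma prob_dists_Lp_rv:
  assumes P: "prob_space P" and "Lp_rv p P U"
  shows "distr P borel U \<in> prob_dists p"
proof -
  interpret prob_space P by fact
  have [measurable]: "U \<in> borel_measurable P" and "integrable P (\<lambda>\<omega>. norm (U \<omega>) powr p)"
    using assms by (auto simp: Lp_rv_def)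
  then show ?thesis
    by (auto simp: prob_dists_def integrable_distr_eq intro!: prob_space_distr)
qed

lemma integrable_prob_dists:
  assumes [measurable]: "U \<in> borel_measurable P" and "distr P borel U \<in> prob_dists 1"
  shows "integrable P U"
proof -
  have "integrable P (\<lambda>\<omega>. norm (U \<omega>))"
    using assms by (simp add: prob_dists_def integrable_distr_eq)
  then show ?thesis
    by (rule integrable_norm_cancel) measurable
qed

theorem proposition4p2:
  fixes P :: "'a measure"
    and T p \<rho> L L' :: real
    and M :: nat
    and b :: "real \<Rightarrow> real ^ 'd \<Rightarrow> (real ^ 'd) measure \<Rightarrow> real ^ 'd"
    and \<sigma> \<theta> :: "real \<Rightarrow> real ^ 'd \<Rightarrow> (real ^ 'd) measure \<Rightarrow> real ^ 'q ^ 'd"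
    and X0 Y0 :: "'a \<Rightarrow> real ^ 'd"
    and Z :: "nat \<Rightarrow> 'a \<Rightarrow> real ^ 'q"
  defines "bs \<equiv> drift_step T M b"
    and "\<sigma>s \<equiv> diffusion_step T M \<sigma>"
    and "\<theta>s \<equiv> diffusion_step T M \<theta>"
  assumes "prob_space P" and "T > 0" and "M \<ge> 1" and "p \<ge> 2"
    and "Lp_rv p P X0" and "Lp_rv p P Y0"
    and "0 < \<rho>" and "\<rho> \<le> 1" and "L > 0" and "L' > 0"
    and "holder_lipschitz norm p T \<rho> L L' b"
    and "holder_lipschitz op_norm p T \<rho> L L' \<sigma>"
    and "holder_lipschitz op_norm p T \<rho> L L' \<theta>"
    and "\<And>m \<mu>. m \<le> M \<Longrightarrow> \<mu> \<in> prob_dists p \<Longrightarrow>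
           \<exists>(A :: real ^ 'd ^ 'd) c. \<forall>x. bs m x \<mu> = A *v x + c"
    and "\<And>m x \<mu> \<nu>. m \<le> M \<Longrightarrow> \<mu> \<in> prob_dists p \<Longrightarrow> \<nu> \<in> prob_dists p \<Longrightarrow> \<mu> \<preceq>\<^sub>c\<^sub>v \<nu> \<Longrightarrow>
           bs m x \<mu> = bs m x \<nu>"
    and "\<And>m x y l \<mu>. m \<le> M \<Longrightarrow> 0 \<le> l \<Longrightarrow> l \<le> 1 \<Longrightarrow> \<mu> \<in> prob_dists p \<Longrightarrow>
           \<sigma>s m (l *\<^sub>R x + (1 - l) *\<^sub>R y) \<mu> \<preceq>\<^sub>M l *\<^sub>R \<sigma>s m x \<mu> + (1 - l) *\<^sub>R \<sigma>s m y \<mu>"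
    and "\<And>m x \<mu> \<nu>. m \<le> M \<Longrightarrow> \<mu> \<in> prob_dists p \<Longrightarrow> \<nu> \<in> prob_dists p \<Longrightarrow> \<mu> \<preceq>\<^sub>c\<^sub>v \<nu> \<Longrightarrow>
           \<sigma>s m x \<mu> \<preceq>\<^sub>M \<sigma>s m x \<nu>"
    and "\<And>m x \<mu>. m \<le> M \<Longrightarrow> \<mu> \<in> prob_dists p \<Longrightarrow> \<sigma>s m x \<mu> \<preceq>\<^sub>M \<theta>s m x \<mu>"
    and "cv_le_rv P X0 Y0"
    and "prob_space.indep_vars P (\<lambda>_. borel) Z {1..M}"
    and "\<And>m. m \<in> {1..M} \<Longrightarrow> distributed P lborel (Z m) (\<lambda>z. ennreal (std_gaussian_density z))"
    and "indep_rv P borel (\<lambda>\<omega>. (X0 \<omega>, Y0 \<omega>))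
           (PiM {1..M} (\<lambda>_. borel)) (\<lambda>\<omega>. \<lambda>m\<in>{1..M}. Z m \<omega>)"
  shows "\<forall>m\<le>M. cv_le_rv P (euler_scheme P bs \<sigma>s Z X0 m) (euler_scheme P bs \<theta>s Z Y0 m)"
proof -
  note P = assms(4) and T = assms(5) and M = assms(6) and p = assms(7) and hl\<sigma> = assms(15) and hl\<theta> = assms(16)
    and aff = assms(17) and drift = assms(18) and \<sigma>_convex = assms(19) and \<sigma>_mono = assms(20) and \<sigma>_le_\<theta> = assms(21)
    and cv0 = assms(22) and indZ = assms(23) and lawZ = assms(24) and ind = assms(25)
  interpret prob_space P by (rule P)
  have X0 [measurable]: "X0 \<in> borel_measurable P" and Y0 [measurable]: "Y0 \<in> borel_measurable P"
    using assms(8,9) by (auto simp: Lp_rv_def)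
  have Z: "Z k \<in> borel_measurable P" and distr_Z: "distr P borel (Z k) = gauss" if "k \<in> {1..M}" for k
  proof -
    show "Z k \<in> borel_measurable P"
      using lawZ[OF that] by (auto simp: distributed_def)
    \<comment> \<open>The density refers to \<open>lborel\<close> and the scheme to
      \<open>borel\<close>, which have the same measurable sets.\<close>
    have "distr P borel (Z k) = distr P lborel (Z k)"
      by (rule distr_cong) auto
    then show "distr P borel (Z k) = gauss"
      using lawZ[OF that] by (simp add: distributed_def gauss_def)
  qed
  have "distr P (PiM {1..M} (\<lambda>_. borel)) (\<lambda>\<omega>. \<lambda>k\<in>{1..M}. Z k \<omega>) = PiM {1..M} (\<lambda>k. distr P borel (Z k))"
    using indZ M Z by (subst (asm) indep_vars_iff_distr_eq_PiM') auto
  also have "\<dots> = PiM {1..M} (\<lambda>_. gauss)"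
    by (intro PiM_cong distr_Z) auto
  finally have noise: "distr P (PiM {1..M} (\<lambda>_. borel)) (\<lambda>\<omega>. \<lambda>k\<in>{1..M}. Z k \<omega>) = PiM {1..M} (\<lambda>_. gauss)" .
  have jointX: "distr P (borel \<Otimes>\<^sub>M PiM {1..M} (\<lambda>_. borel)) (\<lambda>\<omega>. (X0 \<omega>, \<lambda>k\<in>{1..M}. Z k \<omega>))
      = distr P borel X0 \<Otimes>\<^sub>M PiM {1..M} (\<lambda>_. gauss)"
    and jointY: "distr P (borel \<Otimes>\<^sub>M PiM {1..M} (\<lambda>_. borel)) (\<lambda>\<omega>. (Y0 \<omega>, \<lambda>k\<in>{1..M}. Z k \<omega>))
      = distr P borel Y0 \<Otimes>\<^sub>M PiM {1..M} (\<lambda>_. gauss)"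
    using indep_rv_joint_law[OF P ind, of fst borel] indep_rv_joint_law[OF P ind, of snd borel]
    by (simp_all add: noise[simplified] borel_measurable_continuous_onI continuous_on_fst continuous_on_snd)
  have step\<sigma>: "\<exists>A c K. euler_step (\<lambda>x. bs m x \<mu>) (\<lambda>x. \<sigma>s m x \<mu>) A c K"
    and step\<theta>: "\<exists>A c K. euler_step (\<lambda>x. bs m x \<mu>) (\<lambda>x. \<theta>s m x \<mu>) A c K"
    if m: "m < M" and \<mu>: "\<mu> \<in> prob_dists p" for m \<mu>
  proof -
    obtain A c where "\<And>x. bs m x \<mu> = A *v x + c"
      using aff[of m \<mu>] m \<mu> by auto
    note hl = euler_step_holder_lipschitz[OF _ less_imp_le[OF m] T M \<mu> this]
    show "\<exists>A c K. euler_step (\<lambda>x. bs m x \<mu>) (\<lambda>x. \<sigma>s m x \<mu>) A c K"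
      "\<exists>A c K. euler_step (\<lambda>x. bs m x \<mu>) (\<lambda>x. \<theta>s m x \<mu>) A c K"
      using hl[OF hl\<sigma>] hl[OF hl\<theta>] unfolding \<sigma>s_def \<theta>s_def by metis+
  qed
  have p0: "0 \<le> p" using p by simp
  let ?X = "euler_scheme P bs \<sigma>s Z X0" and ?Y = "euler_scheme P bs \<theta>s Z Y0"
  let ?\<mu> = "\<lambda>m. distr P borel (?X m)" and ?\<nu> = "\<lambda>m. distr P borel (?Y m)"
  have X: "?X m \<in> borel_measurable P" "?\<mu> m \<in> prob_dists p"
    "m < M \<Longrightarrow> ?\<mu> (Suc m) = euler_step.next_law (\<lambda>x. bs m x (?\<mu> m)) (\<lambda>x. \<sigma>s m x (?\<mu> m)) (?\<mu> m)"
    if "m \<le> M" for m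
    by (rule euler_scheme_law[where bs = bs and ss = \<sigma>s, OF P X0 p0 prob_dists_Lp_rv[OF P assms(8)] Z jointX step\<sigma> that]; assumption)+
  have Y: "?Y m \<in> borel_measurable P" "?\<nu> m \<in> prob_dists p"
    "m < M \<Longrightarrow> ?\<nu> (Suc m) = euler_step.next_law (\<lambda>x. bs m x (?\<nu> m)) (\<lambda>x. \<theta>s m x (?\<nu> m)) (?\<nu> m)"
    if "m \<le> M" for m
    by (rule euler_scheme_law[where bs = bs and ss = \<theta>s, OF P Y0 p0 prob_dists_Lp_rv[OF P assms(9)] Z jointY step\<theta> that]; assumption)+
  have cv: "?\<mu> m \<preceq>\<^sub>c\<^sub>v ?\<nu> m" if "m \<le> M" for m
    using that
  proof (induction m)
    case 0
    then show ?case
      using cv0 by (simp add: cv_le_rv_def)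
  next
    case (Suc m)
    then have m: "m < M" "m \<le> M" and le: "?\<mu> m \<preceq>\<^sub>c\<^sub>v ?\<nu> m" by auto
    have \<mu>: "?\<mu> m \<in> prob_dists p" and \<nu>: "?\<nu> m \<in> prob_dists p"
      using X(2)[OF m(2)] Y(2)[OF m(2)] by auto
    \<comment> \<open>The induction hypothesis enters here for the first time: it lets both chains
      use the drift at the larger law.\<close>
    have b_eq: "bs m x (?\<mu> m) = bs m x (?\<nu> m)" for x
      by (rule drift[OF m(2) \<mu> \<nu> le])
    obtain A c K where s: "euler_step (\<lambda>x. bs m x (?\<nu> m)) (\<lambda>x. \<sigma>s m x (?\<mu> m)) A c K"
      using step\<sigma>[OF m(1) \<mu>] unfolding b_eq by blast
    obtain A' c' K' where t: "euler_step (\<lambda>x. bs m x (?\<nu> m)) (\<lambda>x. \<theta>s m x (?\<nu> m)) A' c' K'"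
      using step\<theta>[OF m(1) \<nu>] by blast
    \<comment> \<open>Second use of the induction hypothesis: the law is enlarged within \<sigma>,
      and \<sigma> is then exchanged for \<theta> at the larger law.\<close>
    have "\<sigma>s m x (?\<mu> m) \<preceq>\<^sub>M \<theta>s m x (?\<nu> m)" for x
      by (rule mat_le_trans[OF \<sigma>_mono[OF m(2) \<mu> \<nu> le] \<sigma>_le_\<theta>[OF m(2) \<nu>]])
    then have "euler_step.next_law (\<lambda>x. bs m x (?\<nu> m)) (\<lambda>x. \<sigma>s m x (?\<mu> m)) (?\<mu> m)
        \<preceq>\<^sub>c\<^sub>v euler_step.next_law (\<lambda>x. bs m x (?\<nu> m)) (\<lambda>x. \<theta>s m x (?\<nu> m)) (?\<nu> m)"
      by (intro next_law_cv_mono[OF le s t] \<sigma>_convex[OF m(2) _ _ \<mu>])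
    then show ?case
      using X(3)[OF m(2) m(1)] Y(3)[OF m(2) m(1)] unfolding b_eq by (simp only:)
  qed
  show ?thesis
  proof (intro allI impI)
    fix m assume m: "m \<le> M"
    have "?\<mu> m \<in> prob_dists 1" "?\<nu> m \<in> prob_dists 1"
      using cv[OF m] by (auto simp: cv_le_def)
    then show "cv_le_rv P (?X m) (?Y m)"
      using cv[OF m] X(1)[OF m] Y(1)[OF m] by (auto simp: cv_le_rv_def intro!: integrable_prob_dists)
  qed
qed

end
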